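(* Let the data satisfy the standing assumptions (1)-(3) of the context. The fully discrete scheme defined in the context is stable: for every $\kappa>0$ there exist $\Delta t_0\in(0,\overline{\Delta t}]$ and $C>0$ such that, for all $\Delta t\in(0,\Delta t_0]$ and all meshes of size $\Delta x$ with $(\Delta x)^2/\Delta t\le\kappa$, the solution $U$ of the scheme satisfies $$\max_{k\in\mathcal I_{\Delta t}^*,\ i\in\mathcal I_{\Delta x}}|U_{k,i}|\le C.$$
   Context: **Data and standing assumptions.** $T>0$; $A\subset\mathbb{R}^{N_A}$, $B\subset\mathbb{R}^{N_B}$ are nonempty compact sets; $\mathcal V\subseteq\mathbb{R}^{N_B}$ is open with $B\subset\mathcal V$; $1\le N_\sigma\le N$; $\sigma:[0,T]\times\overline{\mathcal{O}}\times A\to\mathbb{R}^{N\times N_\sigma}$ with columns $\sigma^1,\dots,\sigma^{N_\sigma}$; $\mu:[0,T]\times\overline{\mathcal{O}}\times A\to\mathbb{R}^N$; $f:[0,T]\times\overline{\mathcal{O}}\times A\to\mathbb{R}$; $\gamma:\partial\mathcal{O}\times\mathcal V\to\mathbb{R}^N$, written $\gamma_b(x)=\gamma(x,b)$; $g:[0,T]\times\partial\mathcal{O}\times B\to\mathbb{R}$; $\Psi:\overline{\mathcal{O}}\to\mathbb{R}$. (1) $\mathcal{O}\subseteq\mathbb{R}^N$ ($1\le N\le3$) is a nonempty bounded domain with boundary of class $C^3$; $n(x)$ is the unit outward normal at $x\in\partial\mathcal{O}$. (2) $\sigma,\mu,f,g,\Psi$ are continuous, and $\sigma(\cdot,\cdot,a)$,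 $\mu(\cdot,\cdot,a)$ are Lipschitz with constants independent of $a\in A$. (3) $\gamma$ is of class $C^1$, and $|\gamma_b(x)|=1$, $\langle n(x),\gamma_b(x)\rangle>0$ for all $(x,b)\in\partial\mathcal{O}\times B$. **Meshes and interpolation.** For each mesh size $\Delta x>0$ under consideration (ranging over a set of positive numbers accumulating at $0$), a polyhedral domain $\mathcal{O}_{\Delta x}\subseteq\mathbb{R}^N$ is given with a triangulation $\mathbb{T}_{\Delta x}$ into simplices $\mathsf T$ with vertex set $\mathcal G_{\Delta x}=\{x_i: i\in\mathcal I_{\Delta x}\}$, $\mathcal I_{\Delta x}=\{1,\dots,N_{\Delta x}\}$, such that: $\Delta x$ is the maximum of the diameters of the simplices; all vertices on $\partial\mathcal{O}_{\Delta x}$ lie on $\partial\mathcal{O}$; at most one face of each element with vertices on $\partial\mathcal{O}_{\Delta x}$ intersects $\partial\mathcal{O}_{\Delta x}$; there is $\delta\in(0,1)$ independent of $\Delta x$ such that each $\mathsf T$ is contained in a ball of radius $\Delta x/\delta$ and contains a ball of radius $\delta\Delta x$. There is also an exact triangulation $\widehat{\mathbb{T}}_{\Delta x}$ of $\overline{\mathcal{O}}$, $\overline{\mathcal{O}}=\bigcup\widehat{\mathsf T}$, with vertices in $\mathcal G_{\Delta x}$, whose elements correspond one-to-one to those of $\mathbb{T}_{\Delta x}$ with the same vertices; only boundary elements may be curved. The map $p_{\Delta x}:\overline{\mathcal{O}}\to\overline{\mathcal{O}}_{\Delta x}\cap\overline{\mathcal{O}}$ is $p_{\Delta x}(x)=p_{\mathsf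 T}(x)$ for $x\in\widehat{\mathsf T}$, where $\mathsf T$ has the same vertices as $\widehat{\mathsf T}$ and $p_{\mathsf T}$ is the projection onto $\mathsf T$. The domains approximate $\mathcal{O}$ to second order: there is $C'>0$ independent of $\Delta x$ with $|x-p_{\Delta x}(x)|\le C'(\Delta x)^2$ for all $x\in\overline{\mathcal{O}}$. Let $\psi_i$ be the $\mathbb{P}_1$ basis functions on $\mathbb{T}_{\Delta x}$ (continuous, affine on each $\mathsf T$, $\psi_i(x_j)=\delta_{ij}$). For $\phi:\mathcal G_{\Delta x}\to\mathbb{R}$, $I[\phi](x)=\sum_{i\in\mathcal I_{\Delta x}}\psi_i(p_{\Delta x}(x))\phi(x_i)$, $x\in\overline{\mathcal{O}}$. **Scheme.** For $\Delta t>0$: $N_{\Delta t}=\lfloor T/\Delta t\rfloor$, $t_k=k\Delta t$, $\mathcal I_{\Delta t}^*=\{0,\dots,N_{\Delta t}-1\}$. For $\ell=1,\dots,N_\sigma$, $y_{k,i}^{\pm,\ell}(a)=x_i+\Delta t\,\mu(t_k,x_i,a)\pm\sqrt{N_\sigma\Delta t}\,\sigma^\ell(t_k,x_i,a)$; $\mathcal I=\{+,-\}\times\{1,\dots,N_\sigma\}$; $\bar c>0$ is a fixed constant. For some (small) $R>0$ there are uniquely determined $C^1$ functions $(x,b)\mapsto p^{\gamma_b}(x)\in\partial\mathcal{O}$ and $(x,b)\mapsto d^{\gamma_b}(x)\in\mathbb{R}$ on $\{x: d(x,\partial\mathcal{O})<R\}\times B$ with $x=p^{\gamma_b}(x)+d^{\gamma_b}(x)\gamma_b(p^{\gamma_b}(x))$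 and $d^{\gamma_b}=0$ on $\partial\mathcal{O}$. There is $\overline{\Delta t}>0$ such that for all $\Delta t\in(0,\overline{\Delta t}]$ the following is well defined, for $k\in\mathcal I_{\Delta t}^*$, $i\in\mathcal I_{\Delta x}$, $a\in A$, $b\in B$, $s\in\mathcal I$: if $y_{k,i}^s(a)\in\overline{\mathcal{O}}$, then $\tilde y_{k,i}^s(a,b)=y_{k,i}^s(a)$, $\tilde d_{k,i}^s(a,b)=0$, $\tilde g_{k,i}^s(a,b)=0$; otherwise, with $y=y_{k,i}^s(a)$, $\tilde y_{k,i}^s(a,b)=p^{\gamma_b}(y)-\bar c\sqrt{\Delta t}\,\gamma_b(p^{\gamma_b}(y))\in\overline{\mathcal{O}}$, $\tilde d_{k,i}^s(a,b)=d^{\gamma_b}(y)+\bar c\sqrt{\Delta t}$, $\tilde g_{k,i}^s(a,b)=g(t_k,p^{\gamma_b}(y),b)$. For $\Phi:\mathcal G_{\Delta x}\to\mathbb{R}$, $$\mathcal S_{k,i}[\Phi](a,b)=\frac1{2N_\sigma}\sum_{s\in\mathcal I}\left[I[\Phi](\tilde y_{k,i}^s(a,b))+\tilde d_{k,i}^s(a,b)\tilde g_{k,i}^s(a,b)\right]+\Delta t\,f(t_k,x_i,a),\qquad S_{k,i}[\Phi]=\inf_{a\in A,\,b\in B}\mathcal S_{k,i}[\Phi](a,b).$$ The fully discrete scheme is $U_{k,i}=S_{k,i}[U_{k+1,(\cdot)}]$ for $(k,i)\in\mathcal I_{\Delta t}^*\times\mathcal I_{\Delta x}$, $U_{N_{\Delta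 t},i}=\Psi(x_i)$ for $i\in\mathcal I_{\Delta x}$. *)

theory Defs
  imports "HOL-Analysis.Analysis"
begin

section \<open>Functions and boundaries of class $C^k$\<close>

text \<open>Meant for open \<open>U\<close>: all iterated directional derivatives up to order \<open>k\<close> exist as Frechet
  derivatives and are continuous.\<close>

primrec Ck_on :: "nat \<Rightarrow> ('a::euclidean_space \<Rightarrow> 'b::real_normed_vector) \<Rightarrow> 'a set \<Rightarrow> bool" where
  "Ck_on 0 f U \<longleftrightarrow> continuous_on U f"
| "Ck_on (Suc k) f U \<longleftrightarrow>
     (\<forall>x\<in>U. f differentiable (at x)) \<and>
     (\<forall>v. Ck_on k (\<lambda>x. frechet_derivative f (at x) v) U)"

text \<open>On a set that need not be open (such as a product of a hypersurface with an open set),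
  class $C^1$ means: locally the restriction of a $C^1$ function defined on an open set.\<close>

definition C1_on_set :: "('a::euclidean_space \<Rightarrow> 'b::real_normed_vector) \<Rightarrow> 'a set \<Rightarrow> bool" where
  "C1_on_set f S \<longleftrightarrow>
     (\<forall>z\<in>S. \<exists>U F. open U \<and> z \<in> U \<and> Ck_on 1 F U \<and> (\<forall>w\<in>S \<inter> U. F w = f w))"

definition local_defining_function ::
    "nat \<Rightarrow> 'a::euclidean_space set \<Rightarrow> 'a set \<Rightarrow> ('a \<Rightarrow> real) \<Rightarrow> bool" where
  "local_defining_function k \<Omega> U \<rho> \<longleftrightarrow>
     open U \<and> Ck_on k \<rho> U \<and>
     (\<forall>x\<in>U. frechet_derivative \<rho> (at x) \<noteq> (\<lambda>_. 0)) \<and>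
     \<Omega> \<inter> U = {x \<in> U. \<rho> x < 0} \<and>
     frontier \<Omega> \<inter> U = {x \<in> U. \<rho> x = 0}"

definition boundary_of_class :: "nat \<Rightarrow> 'a::euclidean_space set \<Rightarrow> bool" where
  "boundary_of_class k \<Omega> \<longleftrightarrow>
     (\<forall>x\<in>frontier \<Omega>. \<exists>U \<rho>. x \<in> U \<and> local_defining_function k \<Omega> U \<rho>)"

text \<open>The normalised gradient of a defining function that is negative inside.\<close>

definition outward_unit_normal :: "'a::euclidean_space set \<Rightarrow> 'a \<Rightarrow> 'a \<Rightarrow> bool" where
  "outward_unit_normal \<Omega> x \<nu> \<longleftrightarrow>
     (\<exists>U \<rho> v. x \<in> U \<and> local_defining_function 1 \<Omega> U \<rho> \<and>
        (\<rho> has_derivative (\<lambda>h. v \<bullet> h)) (at x) \<and> \<nu> = v /\<^sub>R norm v)"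


section \<open>The data\<close>

text \<open>The dimensions $N$, $N_\sigma$, $N_A$, $N_B$ are the cardinalities of the index types
  \<open>'n\<close>, \<open>'m\<close>, \<open>'a\<close>, \<open>'b\<close>. Functions are total; their values outside the stated domains
  are irrelevant.\<close>

record ('n, 'm, 'a, 'b) problem =
  horizon :: real
  dom :: "(real^'n) set"
  ctrlA :: "(real^'a) set"
  ctrlB :: "(real^'b) set"
  nbhdB :: "(real^'b) set"
  sigma :: "real \<Rightarrow> real^'n \<Rightarrow> real^'a \<Rightarrow> real^'m^'n"
  mu :: "real \<Rightarrow> real^'n \<Rightarrow> real^'a \<Rightarrow> real^'n"
  fcost :: "real \<Rightarrow> real^'n \<Rightarrow> real^'a \<Rightarrow> real"
  gam :: "real^'n \<Rightarrow> real^'b \<Rightarrow> real^'n"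
  gcost :: "real \<Rightarrow> real^'n \<Rightarrow> real^'b \<Rightarrow> real"
  Psi :: "real^'n \<Rightarrow> real"

definition standing_assumptions ::
    "('n::finite, 'm::finite, 'a::finite, 'b::finite) problem \<Rightarrow> (real^'n \<Rightarrow> real^'n) \<Rightarrow> bool" where
  "standing_assumptions P n \<longleftrightarrow>
     horizon P > 0 \<and>
     ctrlA P \<noteq> {} \<and> compact (ctrlA P) \<and>
     ctrlB P \<noteq> {} \<and> compact (ctrlB P) \<and>
     open (nbhdB P) \<and> ctrlB P \<subseteq> nbhdB P \<and>
     1 \<le> CARD('m) \<and> CARD('m) \<le> CARD('n) \<and>
     \<comment> \<open>(1)\<close>
     1 \<le> CARD('n) \<and> CARD('n) \<le> 3 \<and>
     dom P \<noteq> {} \<and> open (dom P) \<and> connected (dom P) \<and> bounded (dom P) \<and>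
     boundary_of_class 3 (dom P) \<and>
     (\<forall>x\<in>frontier (dom P). outward_unit_normal (dom P) x (n x)) \<and>
     \<comment> \<open>(2)\<close>
     continuous_on ({0..horizon P} \<times> closure (dom P) \<times> ctrlA P) (\<lambda>(t, x, a). sigma P t x a) \<and>
     continuous_on ({0..horizon P} \<times> closure (dom P) \<times> ctrlA P) (\<lambda>(t, x, a). mu P t x a) \<and>
     continuous_on ({0..horizon P} \<times> closure (dom P) \<times> ctrlA P) (\<lambda>(t, x, a). fcost P t x a) \<and>
     continuous_on ({0..horizon P} \<times> frontier (dom P) \<times> ctrlB P) (\<lambda>(t, x, b). gcost P t x b) \<and>
     continuous_on (closure (dom P)) (Psi P) \<and>
     (\<exists>L. \<forall>a\<in>ctrlA P.
        L-lipschitz_on ({0..horizon P} \<times> closure (dom P)) (\<lambda>(t, x). sigma P t x a)) \<and>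
     (\<exists>L. \<forall>a\<in>ctrlA P.
        L-lipschitz_on ({0..horizon P} \<times> closure (dom P)) (\<lambda>(t, x). mu P t x a)) \<and>
     \<comment> \<open>(3)\<close>
     C1_on_set (\<lambda>(x, b). gam P x b) (frontier (dom P) \<times> nbhdB P) \<and>
     (\<forall>x\<in>frontier (dom P). \<forall>b\<in>ctrlB P. norm (gam P x b) = 1 \<and> n x \<bullet> gam P x b > 0)"


section \<open>Meshes and interpolation\<close>

text \<open>\<open>curved\<close> sends a simplex of the triangulation to the element of the exact triangulation with
  the same vertices; \<open>hat i\<close> is the $P_1$ basis function of the vertex \<open>vtx i\<close>.\<close>

record 'n mesh =
  polydom :: "(real^'n) set"
  nvert :: nat
  vtx :: "nat \<Rightarrow> real^'n"
  elems :: "(real^'n) set set"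
  curved :: "(real^'n) set \<Rightarrow> (real^'n) set"
  proj :: "real^'n \<Rightarrow> real^'n"
  hat :: "nat \<Rightarrow> real^'n \<Rightarrow> real"

definition verts :: "'a::real_vector set \<Rightarrow> 'a set" where
  "verts K = {v. v extreme_point_of K}"

definition polyhedral_domain :: "'a::euclidean_space set \<Rightarrow> bool" where
  "polyhedral_domain D \<longleftrightarrow>
     D \<noteq> {} \<and> open D \<and> connected D \<and> interior (closure D) = D \<and>
     (\<exists>\<P>. finite \<P> \<and> (\<forall>K\<in>\<P>. polytope K) \<and> closure D = \<Union>\<P>)"

text \<open>A face (of codimension one) is said to intersect the boundary
  if its relative interior does. The faces adjacent to a boundary face always touch
  the boundary in lower dimensional faces, which must not count.\<close>

definition straight_mesh :: "(real^'n::finite) set \<Rightarrow> real \<Rightarrow> real \<Rightarrow> 'n mesh \<Rightarrow> bool" where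
  "straight_mesh \<Omega> \<delta> dx m \<longleftrightarrow>
     polyhedral_domain (polydom m) \<and>
     triangulation (elems m) \<and>
     (\<forall>K\<in>elems m. int CARD('n) simplex K) \<and>
     \<Union>(elems m) = closure (polydom m) \<and>
     inj_on (vtx m) {1..nvert m} \<and>
     vtx m ` {1..nvert m} = (\<Union>K\<in>elems m. verts K) \<and>
     dx = Max (diameter ` elems m) \<and>
     (\<forall>i\<in>{1..nvert m}. vtx m i \<in> frontier (polydom m) \<longrightarrow> vtx m i \<in> frontier \<Omega>) \<and>
     (\<forall>K\<in>elems m. \<forall>F F'.
        F facet_of K \<and> verts F \<subseteq> frontier (polydom m) \<and>
        rel_interior F \<inter> frontier (polydom m) \<noteq> {} \<and>
        F' facet_of K \<and> verts F' \<subseteq> frontier (polydom m) \<and>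
        rel_interior F' \<inter> frontier (polydom m) \<noteq> {} \<longrightarrow> F = F') \<and>
     (\<forall>K\<in>elems m. \<exists>c. K \<subseteq> cball c (dx / \<delta>)) \<and>
     (\<forall>K\<in>elems m. \<exists>c. cball c (\<delta> * dx) \<subseteq> K)"

text \<open>A curved simplex is a homeomorphic image of the straight one with the vertices kept fixed;
  its faces are the images of the straight faces, and two elements meet exactly in the common face.
  Since a curved element may share a curved edge with one that has no face of codimension one on
  the boundary (for $N = 3$), every element touching the boundary counts as a boundary element.\<close>

definition exact_triangulation :: "(real^'n::finite) set \<Rightarrow> 'n mesh \<Rightarrow> bool" where
  "exact_triangulation \<Omega> m \<longleftrightarrow>
     closure \<Omega> = (\<Union>K\<in>elems m. curved m K) \<and>
     inj_on (curved m) (elems m) \<and>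
     (\<exists>h. (\<forall>K\<in>elems m. (\<exists>h'. homeomorphism K (curved m K) (h K) h') \<and>
                       (\<forall>v\<in>verts K. h K v = v)) \<and>
          (\<forall>K\<in>elems m. \<forall>K'\<in>elems m. curved m K \<inter> curved m K' = h K ` (K \<inter> K'))) \<and>
     (\<forall>K\<in>elems m. K \<inter> frontier (polydom m) = {} \<longrightarrow> curved m K = K)"

text \<open>If a point lies in several exact elements whose simplices have different nearest points, any
  of these is admitted as the value of \<open>proj\<close>.\<close>

definition mesh_projection :: "(real^'n::finite) set \<Rightarrow> 'n mesh \<Rightarrow> bool" where
  "mesh_projection \<Omega> m \<longleftrightarrow>
     (\<forall>x\<in>closure \<Omega>. proj m x \<in> closure (polydom m) \<inter> closure \<Omega> \<and>
        (\<exists>K\<in>elems m. x \<in> curved m K \<and> proj m x = closest_point K x))"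

definition P1_basis :: "'n::finite mesh \<Rightarrow> bool" where
  "P1_basis m \<longleftrightarrow>
     (\<forall>i\<in>{1..nvert m}.
        continuous_on (\<Union>(elems m)) (hat m i) \<and>
        (\<forall>K\<in>elems m. \<exists>c v. \<forall>x\<in>K. hat m i x = c + v \<bullet> x) \<and>
        (\<forall>j\<in>{1..nvert m}. hat m i (vtx m j) = (if i = j then 1 else 0)))"

definition mesh_family :: "(real^'n::finite) set \<Rightarrow> real set \<Rightarrow> (real \<Rightarrow> 'n mesh) \<Rightarrow> bool" where
  "mesh_family \<Omega> H M \<longleftrightarrow>
     H \<subseteq> {0<..} \<and> 0 islimpt H \<and>
     (\<exists>\<delta>. 0 < \<delta> \<and> \<delta> < 1 \<and> (\<forall>dx\<in>H. straight_mesh \<Omega> \<delta> dx (M dx))) \<and>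
     (\<forall>dx\<in>H. exact_triangulation \<Omega> (M dx) \<and> mesh_projection \<Omega> (M dx) \<and> P1_basis (M dx)) \<and>
     (\<exists>C'>0. \<forall>dx\<in>H. \<forall>x\<in>closure \<Omega>. norm (x - proj (M dx) x) \<le> C' * dx\<^sup>2)"

text \<open>Grid functions are indexed by the vertex numbers.\<close>

definition interp :: "'n::finite mesh \<Rightarrow> (nat \<Rightarrow> real) \<Rightarrow> real^'n \<Rightarrow> real" where
  "interp m \<phi> x = (\<Sum>i = 1..nvert m. hat m i (proj m x) * \<phi> i)"


section \<open>Oblique projection onto the boundary\<close>

definition tube :: "'a::metric_space set \<Rightarrow> real \<Rightarrow> 'a set" where
  "tube \<Omega> R = {x. infdist x (frontier \<Omega>) < R}"

definition oblique_projection ::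
    "('n::finite, 'm::finite, 'a::finite, 'b::finite) problem \<Rightarrow> real \<Rightarrow>
     (real^'n \<Rightarrow> real^'b \<Rightarrow> real^'n) \<Rightarrow> (real^'n \<Rightarrow> real^'b \<Rightarrow> real) \<Rightarrow> bool" where
  "oblique_projection P R p d \<longleftrightarrow>
     C1_on_set (\<lambda>(x, b). p x b) (tube (dom P) R \<times> ctrlB P) \<and>
     C1_on_set (\<lambda>(x, b). d x b) (tube (dom P) R \<times> ctrlB P) \<and>
     (\<forall>x\<in>tube (dom P) R. \<forall>b\<in>ctrlB P.
        p x b \<in> frontier (dom P) \<and> x = p x b + d x b *\<^sub>R gam P (p x b) b) \<and>
     (\<forall>x\<in>frontier (dom P). \<forall>b\<in>ctrlB P. d x b = 0)"

definition unique_oblique_projection ::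
    "('n::finite, 'm::finite, 'a::finite, 'b::finite) problem \<Rightarrow> real \<Rightarrow>
     (real^'n \<Rightarrow> real^'b \<Rightarrow> real^'n) \<Rightarrow> (real^'n \<Rightarrow> real^'b \<Rightarrow> real) \<Rightarrow> bool" where
  "unique_oblique_projection P R p d \<longleftrightarrow>
     oblique_projection P R p d \<and>
     (\<forall>p' d'. oblique_projection P R p' d' \<longrightarrow>
        (\<forall>x\<in>tube (dom P) R. \<forall>b\<in>ctrlB P. p' x b = p x b \<and> d' x b = d x b))"


section \<open>The fully discrete scheme\<close>

definition num_steps :: "('n::finite, 'm::finite, 'a::finite, 'b::finite) problem \<Rightarrow> real \<Rightarrow> nat" where
  "num_steps P dt = nat \<lfloor>horizon P / dt\<rfloor>"

text \<open>The index set $\{+,-\} \times \{1,\dots,N_\sigma\}$, the signs being the reals 1 and -1.\<close>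

abbreviation branches :: "(real \<times> 'm::finite) set" where
  "branches \<equiv> {1, -1} \<times> UNIV"

definition ypt ::
    "('n::finite, 'm::finite, 'a::finite, 'b::finite) problem \<Rightarrow> 'n mesh \<Rightarrow> real \<Rightarrow>
     nat \<Rightarrow> nat \<Rightarrow> real \<times> 'm \<Rightarrow> real^'a \<Rightarrow> real^'n" where
  "ypt P m dt k i s a =
     vtx m i + dt *\<^sub>R mu P (real k * dt) (vtx m i) a
       + (fst s * sqrt (real CARD('m) * dt)) *\<^sub>R
           column (snd s) (sigma P (real k * dt) (vtx m i) a)"

definition reflected ::
    "('n::finite, 'm::finite, 'a::finite, 'b::finite) problem \<Rightarrow> real \<Rightarrow>
     (real^'n \<Rightarrow> real^'b \<Rightarrow> real^'n) \<Rightarrow> real \<Rightarrow> real^'n \<Rightarrow> real^'b \<Rightarrow> real^'n" where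
  "reflected P cbar p dt y b = p y b - (cbar * sqrt dt) *\<^sub>R gam P (p y b) b"

definition ytil ::
    "('n::finite, 'm::finite, 'a::finite, 'b::finite) problem \<Rightarrow> real \<Rightarrow>
     (real^'n \<Rightarrow> real^'b \<Rightarrow> real^'n) \<Rightarrow> 'n mesh \<Rightarrow> real \<Rightarrow>
     nat \<Rightarrow> nat \<Rightarrow> real \<times> 'm \<Rightarrow> real^'a \<Rightarrow> real^'b \<Rightarrow> real^'n" where
  "ytil P cbar p m dt k i s a b =
     (let y = ypt P m dt k i s a
      in if y \<in> closure (dom P) then y else reflected P cbar p dt y b)"

definition dtil ::
    "('n::finite, 'm::finite, 'a::finite, 'b::finite) problem \<Rightarrow> real \<Rightarrow>
     (real^'n \<Rightarrow> real^'b \<Rightarrow> real) \<Rightarrow> 'n mesh \<Rightarrow> real \<Rightarrow>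
     nat \<Rightarrow> nat \<Rightarrow> real \<times> 'm \<Rightarrow> real^'a \<Rightarrow> real^'b \<Rightarrow> real" where
  "dtil P cbar d m dt k i s a b =
     (let y = ypt P m dt k i s a
      in if y \<in> closure (dom P) then 0 else d y b + cbar * sqrt dt)"

definition gtil ::
    "('n::finite, 'm::finite, 'a::finite, 'b::finite) problem \<Rightarrow>
     (real^'n \<Rightarrow> real^'b \<Rightarrow> real^'n) \<Rightarrow> 'n mesh \<Rightarrow> real \<Rightarrow>
     nat \<Rightarrow> nat \<Rightarrow> real \<times> 'm \<Rightarrow> real^'a \<Rightarrow> real^'b \<Rightarrow> real" where
  "gtil P p m dt k i s a b =
     (let y = ypt P m dt k i s a
      in if y \<in> closure (dom P) then 0 else gcost P (real k * dt) (p y b) b)"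

text \<open>Well-definedness up to the step \<open>dtbar\<close>: a point leaving the closed domain stays in the region
  where the oblique projection is defined, and is reflected into the closed domain.\<close>

definition scheme_well_defined ::
    "('n::finite, 'm::finite, 'a::finite, 'b::finite) problem \<Rightarrow> real set \<Rightarrow> (real \<Rightarrow> 'n mesh) \<Rightarrow>
     real \<Rightarrow> (real^'n \<Rightarrow> real^'b \<Rightarrow> real^'n) \<Rightarrow> real \<Rightarrow> real \<Rightarrow> bool" where
  "scheme_well_defined P H M R p cbar dtbar \<longleftrightarrow>
     (\<forall>dt\<in>{0<..dtbar}. \<forall>dx\<in>H. \<forall>k<num_steps P dt. \<forall>i\<in>{1..nvert (M dx)}.
      \<forall>a\<in>ctrlA P. \<forall>b\<in>ctrlB P. \<forall>s\<in>branches.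
        let y = ypt P (M dx) dt k i s a
        in y \<notin> closure (dom P) \<longrightarrow>
             y \<in> tube (dom P) R \<and> reflected P cbar p dt y b \<in> closure (dom P))"

definition Sab ::
    "('n::finite, 'm::finite, 'a::finite, 'b::finite) problem \<Rightarrow> real \<Rightarrow>
     (real^'n \<Rightarrow> real^'b \<Rightarrow> real^'n) \<Rightarrow> (real^'n \<Rightarrow> real^'b \<Rightarrow> real) \<Rightarrow> 'n mesh \<Rightarrow> real \<Rightarrow>
     nat \<Rightarrow> nat \<Rightarrow> (nat \<Rightarrow> real) \<Rightarrow> real^'a \<Rightarrow> real^'b \<Rightarrow> real" where
  "Sab P cbar p d m dt k i \<Phi> a b =
     1 / (2 * real CARD('m)) *
       (\<Sum>s\<in>branches. interp m \<Phi> (ytil P cbar p m dt k i s a b)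
                       + dtil P cbar d m dt k i s a b * gtil P p m dt k i s a b)
     + dt * fcost P (real k * dt) (vtx m i) a"

definition Sop ::
    "('n::finite, 'm::finite, 'a::finite, 'b::finite) problem \<Rightarrow> real \<Rightarrow>
     (real^'n \<Rightarrow> real^'b \<Rightarrow> real^'n) \<Rightarrow> (real^'n \<Rightarrow> real^'b \<Rightarrow> real) \<Rightarrow> 'n mesh \<Rightarrow> real \<Rightarrow>
     nat \<Rightarrow> nat \<Rightarrow> (nat \<Rightarrow> real) \<Rightarrow> real" where
  "Sop P cbar p d m dt k i \<Phi> = (INF (a, b)\<in>ctrlA P \<times> ctrlB P. Sab P cbar p d m dt k i \<Phi> a b)"

definition solves_scheme ::
    "('n::finite, 'm::finite, 'a::finite, 'b::finite) problem \<Rightarrow> real \<Rightarrow>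
     (real^'n \<Rightarrow> real^'b \<Rightarrow> real^'n) \<Rightarrow> (real^'n \<Rightarrow> real^'b \<Rightarrow> real) \<Rightarrow> 'n mesh \<Rightarrow> real \<Rightarrow>
     (nat \<Rightarrow> nat \<Rightarrow> real) \<Rightarrow> bool" where
  "solves_scheme P cbar p d m dt U \<longleftrightarrow>
     (\<forall>k<num_steps P dt. \<forall>i\<in>{1..nvert m}. U k i = Sop P cbar p d m dt k i (U (Suc k))) \<and>
     (\<forall>i\<in>{1..nvert m}. U (num_steps P dt) i = Psi P (vtx m i))"

end

theory Submission
  imports Defs
begin

text \<open>The naive estimate fails: a branch that leaves the domain pays \<open>dtil * gtil\<close>, which is of order
\<open>sqrt dt\<close>, and there are of order \<open>1 / dt\<close> steps. The remedy is a barrier \<open>w\<close> with Lipschitz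
gradient that vanishes on the boundary, is nonnegative outside the domain and grows at rate at
least \<open>1\<close> along every reflection direction \<open>gam x b\<close> on the boundary. If \<open>y\<close> has left the
domain, its reflected point is \<open>y - dtil * gam (p y b) b\<close>, so reflecting lowers \<open>w\<close> by at least
\<open>dtil\<close>, up to an error of order \<open>dt\<close>. A multiple of \<open>w\<close> thus absorbs every boundary cost.

With \<open>W\<close> bounding the data, a bound \<open>\<bar>U (k+1) j\<bar> \<le> A + W * w (x j)\<close> at all vertices therefore gives
\<open>\<bar>U k i\<bar> \<le> A + c * dt + W * w (x i)\<close>. Every error made on the way is of order \<open>dt\<close>: the
average of \<open>w\<close> over the branches differs from \<open>w (x i)\<close> by a drift term and a second order
remainder, the first order diffusion terms of opposite branches cancelling; the \<open>P1\<close>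
interpolation and the projection onto the mesh cost of order \<open>dx\<^sup>2 \<le> \<kappa> * dt\<close>. Summing over the at
most \<open>T / dt\<close> steps gives the claim.

Two points need compactness. The barrier is a finite sum of local defining functions of the
domain, each multiplied by a bump; since the defining functions vanish on the boundary, only their
gradients survive there, and these are positive multiples of the normal (\<open>ex_oblique_barrier\<close>).
The oblique distance of an exiting point is of order \<open>sqrt dt\<close>, because the distance function is
Lipschitz near the boundary and vanishes on it (\<open>oblique_distance_lipschitz\<close>). Its sign also
matters, since \<open>dtil\<close> must be nonnegative to be absorbed. It follows from the barrier itself: moving
a short way from the boundary against the reflection direction makes \<open>w\<close> negative, while \<open>w\<close> is
nonnegative outside the domain (\<open>barrier_reflection\<close>).\<close>

section \<open>Taylor estimates with Lipschitz gradient\<close>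

lemma Ck_on_Suc_imp: "Ck_on (Suc k) f U \<Longrightarrow> Ck_on k f U"
proof (induction k arbitrary: f)
  case 0
  then show ?case
    by (auto intro!: continuous_at_imp_continuous_on differentiable_imp_continuous_within)
next
  case (Suc k)
  then show ?case
    by (metis Ck_on.simps(2))
qed

lemma Ck_on_1_imp_lipschitz:
  fixes f :: "'a::euclidean_space \<Rightarrow> 'b::real_normed_vector"
  assumes f: "Ck_on 1 f U" and S: "compact S" "convex S" "S \<subseteq> U"
  shows "\<exists>L\<ge>0. \<forall>x\<in>S. \<forall>y\<in>S. norm (f x - f y) \<le> L * norm (x - y)"
proof -
  have der: "(f has_derivative frechet_derivative f (at x)) (at x within S)" if "x \<in> S" for x
  proof -
    have "f differentiable (at x)" using f S that by auto
    then show ?thesis by (metis frechet_derivative_works has_derivative_at_withinI)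
  qed
  have "\<exists>B. \<forall>x\<in>S. norm (frechet_derivative f (at x) i) \<le> B" for i
  proof -
    have "continuous_on S (\<lambda>x. frechet_derivative f (at x) i)"
      using f S by (auto intro: continuous_on_subset)
    then have "bounded ((\<lambda>x. frechet_derivative f (at x) i) ` S)"
      using S by (intro compact_imp_bounded compact_continuous_image)
    then show ?thesis by (auto simp: bounded_iff)
  qed
  then obtain B where B: "\<And>i x. x \<in> S \<Longrightarrow> norm (frechet_derivative f (at x) i) \<le> B i"
    by metis
  define L where "L = max 0 (\<Sum>i\<in>Basis. B i)"
  have "onorm (frechet_derivative f (at x)) \<le> L" if "x \<in> S" for x
    using onorm_componentwise[OF has_derivative_bounded_linear[OF der[OF that]]]
      sum_mono[of Basis "\<lambda>i. norm (frechet_derivative f (at x) i)" B] B[OF that]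
    unfolding L_def by fastforce
  then have "norm (f x - f y) \<le> L * norm (x - y)" if "x \<in> S" "y \<in> S" for x y
    using differentiable_bound[OF S(2) der] that by blast
  moreover have "L \<ge> 0" by (simp add: L_def)
  ultimately show ?thesis by blast
qed

text \<open>A quantitative form of class $C^{1,1}$ with gradient \<open>G\<close>: on a ball the last bound amounts, up to
the constant, to the Lipschitz continuity of \<open>G\<close>. Phrased through the Taylor remainder it is exactly
what a discrete scheme uses, it is stable under sums and products without differentiating again,
and it makes sense on sets that are not open.\<close>

definition C11_on :: "'a::euclidean_space set \<Rightarrow> real \<Rightarrow> ('a \<Rightarrow> real) \<Rightarrow> ('a \<Rightarrow> 'a) \<Rightarrow> bool" where
  "C11_on S K w G \<longleftrightarrow> 0 \<le> K \<and>
     (\<forall>x\<in>S. \<bar>w x\<bar> \<le> K \<and> norm (G x) \<le> K) \<and>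
     (\<forall>x\<in>S. \<forall>y\<in>S. \<bar>w y - w x\<bar> \<le> K * norm (y - x) \<and>
        \<bar>w y - w x - G x \<bullet> (y - x)\<bar> \<le> K * (norm (y - x))\<^sup>2)"

lemma C11_onD:
  assumes "C11_on S K w G" "x \<in> S"
  shows "0 \<le> K" "\<bar>w x\<bar> \<le> K" "norm (G x) \<le> K"
    and "\<And>y. y \<in> S \<Longrightarrow> \<bar>w y - w x\<bar> \<le> K * norm (y - x)"
    and "\<And>y. y \<in> S \<Longrightarrow> \<bar>w y - w x - G x \<bullet> (y - x)\<bar> \<le> K * (norm (y - x))\<^sup>2"
  using assms unfolding C11_on_def by blast+

lemma C11_onI:
  assumes "0 \<le> K"
    and "\<And>x. x \<in> S \<Longrightarrow> \<bar>w x\<bar> \<le> K"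
    and "\<And>x. x \<in> S \<Longrightarrow> norm (G x) \<le> K"
    and "\<And>x y. x \<in> S \<Longrightarrow> y \<in> S \<Longrightarrow> \<bar>w y - w x\<bar> \<le> K * norm (y - x)"
    and "\<And>x y. x \<in> S \<Longrightarrow> y \<in> S \<Longrightarrow>
      \<bar>w y - w x - G x \<bullet> (y - x)\<bar> \<le> K * (norm (y - x))\<^sup>2"
  shows "C11_on S K w G"
  using assms unfolding C11_on_def by blast

definition grad :: "('a::euclidean_space \<Rightarrow> real) \<Rightarrow> 'a \<Rightarrow> 'a" where
  "grad f x = (\<Sum>i\<in>Basis. frechet_derivative f (at x) i *\<^sub>R i)"

lemma has_derivative_grad:
  assumes "f differentiable (at x)"
  shows "(f has_derivative (\<lambda>h. grad f x \<bullet> h)) (at x)"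
proof -
  have D: "(f has_derivative frechet_derivative f (at x)) (at x)"
    using assms by (simp add: frechet_derivative_works)
  interpret bounded_linear "frechet_derivative f (at x)"
    using D by (rule has_derivative_bounded_linear)
  have "frechet_derivative f (at x) h = grad f x \<bullet> h" for h
  proof -
    have "frechet_derivative f (at x) h = frechet_derivative f (at x) (\<Sum>i\<in>Basis. (h \<bullet> i) *\<^sub>R i)"
      by (simp add: euclidean_representation)
    also have "\<dots> = (\<Sum>i\<in>Basis. (h \<bullet> i) * frechet_derivative f (at x) i)"
      by (simp only: sum scaleR real_scaleR_def)
    also have "\<dots> = grad f x \<bullet> h"
      by (simp add: grad_def inner_sum_left inner_commute[of h] mult.commute)
    finally show ?thesis .
  qed
  then have "frechet_derivative f (at x) = (\<lambda>h. grad f x \<bullet> h)" by blast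
  with D show ?thesis by simp
qed

lemma Ck_on_imp_continuous: "Ck_on k f U \<Longrightarrow> continuous_on U f"
  by (induction k) (auto dest: Ck_on_Suc_imp simp del: Ck_on.simps(2))

text \<open>The partial derivatives are \<open>C\<^sup>1\<close>, hence Lipschitz on the compact convex set, so the gradient is
Lipschitz. The remainder is the increment of \<open>f - grad f x \<bullet> _\<close>, whose derivative along the segment
from \<open>x\<close> to \<open>y\<close> is bounded by the Lipschitz constant times \<open>norm (y - x)\<close>.\<close>

lemma Ck_on_2_imp_C11_on:
  fixes f :: "'a::euclidean_space \<Rightarrow> real"
  assumes f: "Ck_on 2 f U" and S: "compact S" "convex S" "S \<subseteq> U"
  shows "\<exists>K. C11_on S K f (grad f)"
proof -
  have f': "Ck_on 1 (\<lambda>x. frechet_derivative f (at x) v) U" for v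
    using f by (simp add: numeral_2_eq_2)
  have f1: "Ck_on 1 f U"
    using f Ck_on_Suc_imp[of 1 f U] by (simp add: numeral_2_eq_2)
  obtain L where L: "L \<ge> 0" "\<And>x y. x \<in> S \<Longrightarrow> y \<in> S \<Longrightarrow> \<bar>f x - f y\<bar> \<le> L * norm (x - y)"
    using Ck_on_1_imp_lipschitz[OF f1 S] by auto
  have "\<exists>L\<ge>0. \<forall>x\<in>S. \<forall>y\<in>S. \<bar>frechet_derivative f (at x) i - frechet_derivative f (at y) i\<bar>
            \<le> L * norm (x - y)" for i
    using Ck_on_1_imp_lipschitz[OF f' S, of i] by simp
  then obtain Q where Q: "\<And>i x y. x \<in> S \<Longrightarrow> y \<in> S \<Longrightarrow>
       \<bar>frechet_derivative f (at x) i - frechet_derivative f (at y) i\<bar> \<le> Q i * norm (x - y)"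
    and Q0: "\<And>i. Q i \<ge> 0"
    by metis
  define q where "q = (\<Sum>i\<in>Basis. Q i)"
  have q0: "q \<ge> 0" unfolding q_def by (simp add: Q0 sum_nonneg)
  have G: "norm (grad f x - grad f y) \<le> q * norm (x - y)" if "x \<in> S" "y \<in> S" for x y
  proof -
    have "norm (grad f x - grad f y)
       \<le> (\<Sum>i\<in>Basis. norm ((frechet_derivative f (at x) i - frechet_derivative f (at y) i) *\<^sub>R i))"
      unfolding grad_def sum_subtractf[symmetric] scaleR_diff_left[symmetric] by (rule norm_sum)
    also have "\<dots> \<le> (\<Sum>i\<in>Basis. Q i * norm (x - y))"
      using Q[OF that] by (intro sum_mono) simp
    finally show ?thesis by (simp add: q_def sum_distrib_right)
  qed
  have cont: "continuous_on S f" "continuous_on S (grad f)"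
    using Ck_on_imp_continuous[OF f] Ck_on_imp_continuous[OF f'] S(3)
    unfolding grad_def by (auto intro!: continuous_intros intro: continuous_on_subset)
  obtain B1 where B1: "\<And>x. x \<in> S \<Longrightarrow> \<bar>f x\<bar> \<le> B1"
    using compact_imp_bounded[OF compact_continuous_image[OF cont(1) S(1)]] by (auto simp: bounded_iff)
  obtain B2 where B2: "\<And>x. x \<in> S \<Longrightarrow> norm (grad f x) \<le> B2"
    using compact_imp_bounded[OF compact_continuous_image[OF cont(2) S(1)]] by (auto simp: bounded_iff)
  have T: "\<bar>f y - f x - grad f x \<bullet> (y - x)\<bar> \<le> q * (norm (y - x))\<^sup>2" if xy: "x \<in> S" "y \<in> S" for x y
  proof -
    have seg: "closed_segment x y \<subseteq> S"
      using S(2) xy by (rule_tac closed_segment_subset)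
    have der: "((\<lambda>z. f z - grad f x \<bullet> z) has_derivative (\<lambda>h. (grad f z - grad f x) \<bullet> h))
        (at z within closed_segment x y)" if z: "z \<in> closed_segment x y" for z
    proof -
      have "f differentiable (at z)"
        using f1 z seg S(3) by auto
      then have "(f has_derivative (\<lambda>h. grad f z \<bullet> h)) (at z within closed_segment x y)"
        by (rule has_derivative_at_withinI[OF has_derivative_grad])
      then show ?thesis
        by (auto intro!: derivative_eq_intros simp: inner_diff_left)
    qed
    have bd: "onorm (\<lambda>h. (grad f z - grad f x) \<bullet> h) \<le> q * norm (y - x)"
      if z: "z \<in> closed_segment x y" for z
    proof (rule onorm_le)
      fix h
      have "norm ((grad f z - grad f x) \<bullet> h) \<le> norm (grad f z - grad f x) * norm h"
        unfolding real_norm_def by (rule Cauchy_Schwarz_ineq2)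
      also have "\<dots> \<le> (q * norm (y - x)) * norm h"
      proof (rule mult_right_mono)
        have "norm (grad f z - grad f x) \<le> q * norm (z - x)"
          using z seg xy by (intro G) auto
        also have "\<dots> \<le> q * norm (y - x)"
          using segment_bound1[OF z] q0 by (intro mult_left_mono)
        finally show "norm (grad f z - grad f x) \<le> q * norm (y - x)" .
      qed simp
      finally show "norm ((grad f z - grad f x) \<bullet> h) \<le> (q * norm (y - x)) * norm h" .
    qed
    have "norm ((f y - grad f x \<bullet> y) - (f x - grad f x \<bullet> x)) \<le> (q * norm (y - x)) * norm (y - x)"
      by (rule differentiable_bound[OF convex_closed_segment der bd]) auto
    then show ?thesis
      by (simp add: inner_diff_right power2_eq_square algebra_simps)
  qed
  define K where "K = \<bar>B1\<bar> + \<bar>B2\<bar> + L + q"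
  have K: "0 \<le> K" "B1 \<le> K" "B2 \<le> K" "L \<le> K" "q \<le> K"
    using L(1) q0 by (auto simp: K_def)
  have "C11_on S K f (grad f)"
  proof (rule C11_onI)
    fix x y assume "x \<in> S" "y \<in> S"
    then show "\<bar>f y - f x\<bar> \<le> K * norm (y - x)"
      "\<bar>f y - f x - grad f x \<bullet> (y - x)\<bar> \<le> K * (norm (y - x))\<^sup>2"
      using L(2)[of y x] T[of x y] K mult_right_mono[of L K "norm (y - x)"]
        mult_right_mono[of q K "(norm (y - x))\<^sup>2"] by auto
  next
    show "0 \<le> K" by (rule K)
    fix x assume "x \<in> S"
    then show "\<bar>f x\<bar> \<le> K" "norm (grad f x) \<le> K" using B1[of x] B2[of x] K by linarith+
  qed
  then show ?thesis by blast
qed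

lemma C11_on_mono:
  assumes "C11_on S K w G" "K \<le> K'"
  shows "C11_on S K' w G"
proof (rule C11_onI)
  show "0 \<le> K'" using assms by (auto simp: C11_on_def)
  fix x assume x: "x \<in> S"
  note D = C11_onD[OF assms(1) x]
  show "\<bar>w x\<bar> \<le> K'" "norm (G x) \<le> K'" using D assms(2) by linarith+
  fix y assume y: "y \<in> S"
  show "\<bar>w y - w x\<bar> \<le> K' * norm (y - x)" "\<bar>w y - w x - G x \<bullet> (y - x)\<bar> \<le> K' * (norm (y - x))\<^sup>2"
    using D(4,5)[OF y] mult_right_mono[OF assms(2), of "norm (y - x)"]
      mult_right_mono[OF assms(2), of "(norm (y - x))\<^sup>2"] by auto
qed

lemma C11_on_add:
  assumes "C11_on S K w G" "C11_on S K' w' G'"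
  shows "C11_on S (K + K') (\<lambda>x. w x + w' x) (\<lambda>x. G x + G' x)"
proof (rule C11_onI)
  show "0 \<le> K + K'" using assms by (auto simp: C11_on_def)
  fix x assume x: "x \<in> S"
  note D = C11_onD[OF assms(1) x] and D' = C11_onD[OF assms(2) x]
  show "\<bar>w x + w' x\<bar> \<le> K + K'" using D D' by linarith
  show "norm (G x + G' x) \<le> K + K'" using D D' norm_triangle_ineq[of "G x" "G' x"] by linarith
  fix y assume y: "y \<in> S"
  show "\<bar>w y + w' y - (w x + w' x)\<bar> \<le> (K + K') * norm (y - x)"
    "\<bar>w y + w' y - (w x + w' x) - (G x + G' x) \<bullet> (y - x)\<bar> \<le> (K + K') * (norm (y - x))\<^sup>2"
    using D(4,5)[OF y] D'(4,5)[OF y] by (auto simp: inner_add_left distrib_right)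
qed

lemma C11_on_scale:
  assumes "C11_on S K w G" "c \<ge> 0"
  shows "C11_on S (c * K) (\<lambda>x. c * w x) (\<lambda>x. c *\<^sub>R G x)"
proof (rule C11_onI)
  show "0 \<le> c * K" using assms by (auto simp: C11_on_def)
  fix x assume x: "x \<in> S"
  note D = C11_onD[OF assms(1) x]
  show "\<bar>c * w x\<bar> \<le> c * K" using D assms(2) by (simp add: abs_mult mult_left_mono)
  show "norm (c *\<^sub>R G x) \<le> c * K" using D assms(2) by (simp add: mult_left_mono)
  fix y assume y: "y \<in> S"
  have "\<bar>c * w y - c * w x\<bar> = c * \<bar>w y - w x\<bar>"
    using assms(2) by (simp add: right_diff_distrib[symmetric] abs_mult)
  then show "\<bar>c * w y - c * w x\<bar> \<le> c * K * norm (y - x)"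
    using mult_left_mono[OF D(4)[OF y] assms(2)] by (simp add: mult.assoc)
  have "c * w y - c * w x - (c *\<^sub>R G x) \<bullet> (y - x) = c * (w y - w x - G x \<bullet> (y - x))"
    by (simp add: algebra_simps)
  then show "\<bar>c * w y - c * w x - (c *\<^sub>R G x) \<bullet> (y - x)\<bar> \<le> c * K * (norm (y - x))\<^sup>2"
    using mult_left_mono[OF D(5)[OF y] assms(2)] assms(2) by (simp add: mult.assoc abs_mult)
qed

text \<open>The remainder of a product consists of the two remainders, each multiplied by a bounded factor,
and of the product of the two increments, which is quadratic because both are Lipschitz.\<close>

lemma C11_on_mult:
  assumes "C11_on S K w G" "C11_on S K' w' G'"
  shows "C11_on S (3 * (K * K')) (\<lambda>x. w x * w' x) (\<lambda>x. w x *\<^sub>R G' x + w' x *\<^sub>R G x)"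
proof (rule C11_onI)
  show "0 \<le> 3 * (K * K')" using assms by (auto simp: C11_on_def)
  fix x assume x: "x \<in> S"
  note D = C11_onD[OF assms(1) x] and D' = C11_onD[OF assms(2) x]
  have KK: "0 \<le> K * K'" using D(1-3) D'(1-3) by simp
  have "\<bar>w x * w' x\<bar> \<le> K * K'"
    unfolding abs_mult using D(1-3) D'(1-3) by (intro mult_mono) auto
  then show "\<bar>w x * w' x\<bar> \<le> 3 * (K * K')" using KK by linarith
  have 1: "\<bar>w x\<bar> * norm (G' x) \<le> K * K'" using D(1-3) D'(1-3) by (intro mult_mono) auto
  have 2: "\<bar>w' x\<bar> * norm (G x) \<le> K' * K" using D(1-3) D'(1-3) by (intro mult_mono) auto
  show "norm (w x *\<^sub>R G' x + w' x *\<^sub>R G x) \<le> 3 * (K * K')"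
    using 1 2 KK norm_triangle_ineq[of "w x *\<^sub>R G' x" "w' x *\<^sub>R G x"] by (simp add: mult.commute)
  fix y assume y: "y \<in> S"
  define e where "e = norm (y - x)"
  note E = D(4,5)[OF y, folded e_def] and E' = D'(4,5)[OF y, folded e_def]
  have wy: "\<bar>w y\<bar> \<le> K" using C11_onD(2)[OF assms(1) y] .
  have "w y * w' y - w x * w' x = w y * (w' y - w' x) + w' x * (w y - w x)"
    by (simp add: algebra_simps)
  moreover have "\<bar>w y * (w' y - w' x)\<bar> \<le> K * (K' * e)"
    unfolding abs_mult using D(1) D'(1) E'(1) wy by (intro mult_mono) auto
  moreover have "\<bar>w' x * (w y - w x)\<bar> \<le> K' * (K * e)"
    unfolding abs_mult using D(1) D'(1,2) E(1) by (intro mult_mono) auto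
  moreover have "K * (K' * e) \<ge> 0" using D(1-3) D'(1-3) by (simp add: e_def)
  ultimately show "\<bar>w y * w' y - w x * w' x\<bar> \<le> 3 * (K * K') * norm (y - x)"
    unfolding e_def[symmetric] by (simp add: algebra_simps)
  have "w y * w' y - w x * w' x - (w x *\<^sub>R G' x + w' x *\<^sub>R G x) \<bullet> (y - x)
     = w x * (w' y - w' x - G' x \<bullet> (y - x)) + w' x * (w y - w x - G x \<bullet> (y - x))
       + (w y - w x) * (w' y - w' x)"
    by (simp add: algebra_simps inner_add_left)
  moreover have "\<bar>w x * (w' y - w' x - G' x \<bullet> (y - x))\<bar> \<le> K * (K' * e\<^sup>2)"
    unfolding abs_mult using D(1,2) D'(1) E'(2) by (intro mult_mono) auto
  moreover have "\<bar>w' x * (w y - w x - G x \<bullet> (y - x))\<bar> \<le> K' * (K * e\<^sup>2)"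
    unfolding abs_mult using D(1) D'(1,2) E(2) by (intro mult_mono) auto
  moreover have "\<bar>(w y - w x) * (w' y - w' x)\<bar> \<le> (K * e) * (K' * e)"
    unfolding abs_mult using D(1) D'(1) E(1) E'(1) by (intro mult_mono) (auto simp: e_def)
  ultimately show "\<bar>w y * w' y - w x * w' x - (w x *\<^sub>R G' x + w' x *\<^sub>R G x) \<bullet> (y - x)\<bar>
      \<le> 3 * (K * K') * (norm (y - x))\<^sup>2"
    unfolding e_def[symmetric] power2_eq_square by (simp add: algebra_simps)
qed

text \<open>The bump is the square of \<open>s x = r\<^sup>2 - (norm (x - x0))\<^sup>2\<close>. The square is what makes both the bump and
its gradient vanish on the sphere, so that products with it extend by zero.\<close>

lemma C11_bump:
  fixes x0 :: "'a::euclidean_space"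
  assumes r: "r > 0" "r \<le> 1"
  shows "C11_on (cball x0 r) 18 (\<lambda>x. (r\<^sup>2 - (norm (x - x0))\<^sup>2)\<^sup>2)
           (\<lambda>x. (- 4 * (r\<^sup>2 - (norm (x - x0))\<^sup>2)) *\<^sub>R (x - x0))"
proof (rule C11_onI)
  have r2: "r\<^sup>2 \<le> 1" using r by (simp add: power_le_one)
  have a: "0 \<le> r\<^sup>2 - (norm (x - x0))\<^sup>2" "r\<^sup>2 - (norm (x - x0))\<^sup>2 \<le> 1" "norm (x - x0) \<le> 1"
    if "x \<in> cball x0 r" for x
  proof -
    have n: "norm (x - x0) \<le> r" using that by (simp add: dist_norm norm_minus_commute)
    then show "0 \<le> r\<^sup>2 - (norm (x - x0))\<^sup>2" by (simp add: power_mono)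
    show "norm (x - x0) \<le> 1" using n r by simp
    show "r\<^sup>2 - (norm (x - x0))\<^sup>2 \<le> 1" using r2 zero_le_power2[of "norm (x - x0)"] by linarith
  qed
  fix x assume x: "x \<in> cball x0 r"
  define s where "s = r\<^sup>2 - (norm (x - x0))\<^sup>2"
  have s: "0 \<le> s" "s \<le> 1" using a[OF x] by (auto simp: s_def)
  have "s\<^sup>2 \<le> 1" using s by (simp add: power_le_one)
  then show "\<bar>(r\<^sup>2 - (norm (x - x0))\<^sup>2)\<^sup>2\<bar> \<le> 18" unfolding s_def[symmetric] by simp
  have "s * norm (x - x0) \<le> 1" using s a(3)[OF x] by (simp add: mult_le_one)
  then show "norm ((- 4 * (r\<^sup>2 - (norm (x - x0))\<^sup>2)) *\<^sub>R (x - x0)) \<le> 18"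
    unfolding s_def[symmetric] using s by simp
  fix y assume y: "y \<in> cball x0 r"
  define s' where "s' = r\<^sup>2 - (norm (y - x0))\<^sup>2"
  have s': "0 \<le> s'" "s' \<le> 1" using a[OF y] by (auto simp: s'_def)
  define e where "e = y - x"
  have yx: "y - x0 = (x - x0) + e" by (simp add: e_def)
  have ee: "norm e \<le> 2" using a(3)[OF x] a(3)[OF y] norm_triangle_ineq4[of "y - x0" "x - x0"]
    by (simp add: e_def)
  have sd: "s' - s = - (2 * ((x - x0) \<bullet> e) + (norm e)\<^sup>2)"
    unfolding s_def s'_def yx power2_norm_eq_inner by (simp add: inner_add_left inner_add_right inner_commute)
  have "\<bar>(x - x0) \<bullet> e\<bar> \<le> norm (x - x0) * norm e" by (rule Cauchy_Schwarz_ineq2)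
  also have "\<dots> \<le> norm e" using a(3)[OF x] by (simp add: mult_left_le_one_le)
  finally have "\<bar>s' - s\<bar> \<le> 2 * norm e + (norm e)\<^sup>2" unfolding sd by (smt (verit) zero_le_power2)
  also have "(norm e)\<^sup>2 \<le> 2 * norm e" using ee by (simp add: power2_eq_square mult_right_mono)
  finally have d: "\<bar>s' - s\<bar> \<le> 4 * norm e" by simp
  have "s'\<^sup>2 - s\<^sup>2 = (s' + s) * (s' - s)" by (simp add: power2_eq_square algebra_simps)
  moreover have "\<bar>(s' + s) * (s' - s)\<bar> \<le> 2 * (4 * norm e)"
    using s s' d unfolding abs_mult by (intro mult_mono) auto
  ultimately have "\<bar>s'\<^sup>2 - s\<^sup>2\<bar> \<le> 2 * (4 * norm e)"
    by simp
  then show "\<bar>(r\<^sup>2 - (norm (y - x0))\<^sup>2)\<^sup>2 - (r\<^sup>2 - (norm (x - x0))\<^sup>2)\<^sup>2\<bar> \<le> 18 * norm (y - x)"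
    unfolding s_def[symmetric] s'_def[symmetric] e_def[symmetric] using norm_ge_zero[of e] by linarith
  \<comment> \<open>Substituting the exact increment of \<open>s\<close> cancels the first order terms.\<close>
  have id: "s'\<^sup>2 - s\<^sup>2 - ((- 4 * s) *\<^sub>R (x - x0)) \<bullet> e = (s' - s)\<^sup>2 - 2 * s * (norm e)\<^sup>2"
  proof -
    have "s'\<^sup>2 - s\<^sup>2 = (s' - s)\<^sup>2 + 2 * s * (s' - s)" by (simp add: power2_eq_square algebra_simps)
    also have "2 * s * (s' - s) = - 4 * s * ((x - x0) \<bullet> e) - 2 * s * (norm e)\<^sup>2"
      unfolding sd by (simp add: algebra_simps)
    finally show ?thesis by simp
  qed
  have "(s' - s)\<^sup>2 \<le> (4 * norm e)\<^sup>2" using d by (metis abs_ge_zero power2_abs power_mono)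
  then have "(s' - s)\<^sup>2 \<le> 16 * (norm e)\<^sup>2" by (simp add: power_mult_distrib)
  moreover have "2 * s * (norm e)\<^sup>2 \<le> 2 * (norm e)\<^sup>2" "0 \<le> 2 * s * (norm e)\<^sup>2"
    using s by (auto simp: mult_left_le_one_le)
  ultimately have "\<bar>(s' - s)\<^sup>2 - 2 * s * (norm e)\<^sup>2\<bar> \<le> 18 * (norm e)\<^sup>2"
    using zero_le_power2[of "s' - s"] zero_le_power2[of "norm e"] by linarith
  then show "\<bar>(r\<^sup>2 - (norm (y - x0))\<^sup>2)\<^sup>2 - (r\<^sup>2 - (norm (x - x0))\<^sup>2)\<^sup>2
       - ((- 4 * (r\<^sup>2 - (norm (x - x0))\<^sup>2)) *\<^sub>R (x - x0)) \<bullet> (y - x)\<bar> \<le> 18 * (norm (y - x))\<^sup>2"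
    unfolding s_def[symmetric] s'_def[symmetric] e_def[symmetric] id .
qed simp

text \<open>A Taylor expansion between a point \<open>x\<close> inside the ball and a point \<open>y\<close> outside has no common
domain of smoothness to work in. But the distance of \<open>x\<close> to the sphere is at most \<open>norm (y - x)\<close>,
so the assumed decay makes each of \<open>w x\<close> and \<open>G x \<bullet> (y - x)\<close> of order \<open>(norm (y - x))\<^sup>2\<close>.\<close>

lemma C11_on_extend_by_zero:
  fixes x0 :: "'a::euclidean_space"
  assumes C: "C11_on (cball x0 r) K w G" and r: "0 \<le> r" "r \<le> 1"
    and w: "\<And>x. x \<in> cball x0 r \<Longrightarrow> \<bar>w x\<bar> \<le> Q * (r - norm (x - x0))\<^sup>2"
    and G: "\<And>x. x \<in> cball x0 r \<Longrightarrow> norm (G x) \<le> Q * (r - norm (x - x0))"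
    and Q: "Q \<ge> 0"
  shows "C11_on UNIV (K + 2 * Q) (\<lambda>x. if x \<in> cball x0 r then w x else 0)
           (\<lambda>x. if x \<in> cball x0 r then G x else 0)"
proof -
  have K: "0 \<le> K" using C by (simp add: C11_on_def)
  let ?K = "K + 2 * Q"
  have KQ: "K \<le> ?K" "0 \<le> ?K" using K Q by auto
  note D = C11_onD[OF C11_on_mono[OF C KQ(1)]]
  have gap: "0 \<le> r - norm (x - x0)" "r - norm (x - x0) \<le> norm (y - x)" "r - norm (x - x0) \<le> 1"
    if "x \<in> cball x0 r" "y \<notin> cball x0 r" for x y
    using that r norm_triangle_ineq[of "y - x" "x - x0"]
    by (auto simp: dist_norm norm_minus_commute) (smt (verit) norm_minus_commute norm_ge_zero)+
  have w1: "\<bar>w x\<bar> \<le> Q * (norm (y - x))\<^sup>2" and w2: "\<bar>w x\<bar> \<le> Q * norm (y - x)"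
    and G1: "norm (G x) \<le> Q * norm (y - x)" and xy: "x \<noteq> y"
    if "x \<in> cball x0 r" "y \<notin> cball x0 r" for x y
  proof -
    note g = gap[OF that]
    show "\<bar>w x\<bar> \<le> Q * (norm (y - x))\<^sup>2"
      using w[OF that(1)] g Q by (smt (verit) mult_left_mono power_mono)
    have "(r - norm (x - x0))\<^sup>2 \<le> r - norm (x - x0)"
      using g by (simp add: power2_eq_square mult_left_le_one_le)
    then show "\<bar>w x\<bar> \<le> Q * norm (y - x)"
      using w[OF that(1)] g Q by (smt (verit) mult_left_mono)
    show "norm (G x) \<le> Q * norm (y - x)"
      using G[OF that(1)] g Q by (smt (verit) mult_left_mono)
    show "x \<noteq> y" using that by auto
  qed
  show ?thesis
  proof (rule C11_onI)
    show "0 \<le> ?K" using KQ by simp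
    fix x
    show "\<bar>if x \<in> cball x0 r then w x else 0\<bar> \<le> ?K"
      "norm (if x \<in> cball x0 r then G x else 0) \<le> ?K"
      using D(2,3)[of x] KQ by (auto simp del: mem_cball)
    fix y
    consider "x \<in> cball x0 r" "y \<in> cball x0 r" | "x \<in> cball x0 r" "y \<notin> cball x0 r"
      | "x \<notin> cball x0 r" "y \<in> cball x0 r" | "x \<notin> cball x0 r" "y \<notin> cball x0 r" by blast
    then have "\<bar>(if y \<in> cball x0 r then w y else 0) - (if x \<in> cball x0 r then w x else 0)\<bar>
          \<le> ?K * norm (y - x) \<and>
        \<bar>(if y \<in> cball x0 r then w y else 0) - (if x \<in> cball x0 r then w x else 0)
         - (if x \<in> cball x0 r then G x else 0) \<bullet> (y - x)\<bar> \<le> ?K * (norm (y - x))\<^sup>2"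
    proof cases
      case 1 then show ?thesis using D(4,5)[of x y] by (simp del: mem_cball)
    next
      case 2
      have "\<bar>G x \<bullet> (y - x)\<bar> \<le> norm (G x) * norm (y - x)" by (rule Cauchy_Schwarz_ineq2)
      also have "\<dots> \<le> Q * (norm (y - x))\<^sup>2"
        using mult_right_mono[OF G1[OF 2], of "norm (y - x)"] by (simp add: power2_eq_square mult.assoc)
      finally have "\<bar>- w x - G x \<bullet> (y - x)\<bar> \<le> 2 * Q * (norm (y - x))\<^sup>2"
        using w1[OF 2] by linarith
      moreover have "2 * Q * (norm (y - x))\<^sup>2 \<le> ?K * (norm (y - x))\<^sup>2" "Q * norm (y - x) \<le> ?K * norm (y - x)"
        using K Q by (auto intro!: mult_right_mono)
      ultimately show ?thesis using 2 w2[OF 2] by (simp del: mem_cball)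
    next
      case 3
      have "Q * (norm (y - x))\<^sup>2 \<le> ?K * (norm (y - x))\<^sup>2" "Q * norm (y - x) \<le> ?K * norm (y - x)"
        using K Q by (auto intro!: mult_right_mono)
      then show ?thesis using 3 w1[OF 3(2,1)] w2[OF 3(2,1)]
        by (simp del: mem_cball add: norm_minus_commute)
    next
      case 4 then show ?thesis using KQ by (simp del: mem_cball)
    qed
    then show "\<bar>(if y \<in> cball x0 r then w y else 0) - (if x \<in> cball x0 r then w x else 0)\<bar>
          \<le> ?K * norm (y - x)"
        "\<bar>(if y \<in> cball x0 r then w y else 0) - (if x \<in> cball x0 r then w x else 0)
         - (if x \<in> cball x0 r then G x else 0) \<bullet> (y - x)\<bar> \<le> ?K * (norm (y - x))\<^sup>2" by auto
  qed
qed

section \<open>A barrier for oblique reflection\<close>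

text \<open>Moving from \<open>x\<close> in a direction \<open>k\<close> with \<open>v \<bullet> k > 0\<close> makes \<open>\<rho>'\<close> positive, hence \<open>\<rho>\<close> nonnegative, so
\<open>u \<bullet> k \<ge> 0\<close>. Applying this to \<open>k = h - \<epsilon> *\<^sub>R u\<close> with small \<open>\<epsilon>\<close>, instead of \<open>h\<close>, makes the inequality
strict.\<close>

lemma gradient_cone_inclusion:
  fixes \<rho> \<rho>' :: "'a::euclidean_space \<Rightarrow> real"
  assumes \<rho>: "(\<rho> has_derivative (\<lambda>h. u \<bullet> h)) (at x)" "\<rho> x = 0"
    and \<rho>': "(\<rho>' has_derivative (\<lambda>h. v \<bullet> h)) (at x)" "\<rho>' x = 0"
    and ev: "eventually (\<lambda>y. \<rho>' y > 0 \<longrightarrow> \<rho> y \<ge> 0) (nhds x)"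
    and u: "u \<noteq> 0" and h: "v \<bullet> h > 0"
  shows "u \<bullet> h > 0"
proof -
  define \<epsilon> where "\<epsilon> = (v \<bullet> h) / (2 * (\<bar>v \<bullet> u\<bar> + 1))"
  have \<epsilon>: "\<epsilon> > 0" using h by (simp add: \<epsilon>_def)
  define k where "k = h - \<epsilon> *\<^sub>R u"
  have "\<epsilon> * (v \<bullet> u) \<le> \<epsilon> * (\<bar>v \<bullet> u\<bar> + 1)" using \<epsilon> by (intro mult_left_mono) auto
  also have "\<dots> = (v \<bullet> h) / 2" by (simp add: \<epsilon>_def field_simps)
  finally have vk: "v \<bullet> k > 0" using h by (simp add: k_def inner_diff_right)
  have line: "((\<lambda>t. f (x + t *\<^sub>R k)) has_real_derivative a \<bullet> k) (at 0)"
    if "(f has_derivative (\<lambda>h. a \<bullet> h)) (at x)" for f :: "'a \<Rightarrow> real" and a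
  proof -
    have "((\<lambda>t. x + t *\<^sub>R k) has_derivative (\<lambda>t. t *\<^sub>R k)) (at (0::real))"
      by (auto intro!: derivative_eq_intros)
    moreover have "(f has_derivative (\<lambda>h. a \<bullet> h)) (at (x + 0 *\<^sub>R k))" using that by simp
    ultimately have "((\<lambda>t. f (x + t *\<^sub>R k)) has_derivative (\<lambda>t. a \<bullet> (t *\<^sub>R k))) (at 0)"
      by (rule has_derivative_compose)
    then show ?thesis by (simp add: has_field_derivative_def mult.commute[of _ "a \<bullet> k"])
  qed
  have "u \<bullet> k \<ge> 0"
  proof (rule ccontr)
    assume "\<not> u \<bullet> k \<ge> 0"
    then have "u \<bullet> k < 0" by simp
    from DERIV_neg_dec_right[OF line[OF \<rho>(1)] this]
    obtain d1 where d1: "d1 > 0" "\<And>t. 0 < t \<Longrightarrow> t < d1 \<Longrightarrow> \<rho> (x + t *\<^sub>R k) < 0"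
      using \<rho>(2) by auto
    from DERIV_pos_inc_right[OF line[OF \<rho>'(1)] vk]
    obtain d2 where d2: "d2 > 0" "\<And>t. 0 < t \<Longrightarrow> t < d2 \<Longrightarrow> \<rho>' (x + t *\<^sub>R k) > 0"
      using \<rho>'(2) by auto
    obtain e where e: "e > 0" "\<And>y. dist y x < e \<Longrightarrow> \<rho>' y > 0 \<Longrightarrow> \<rho> y \<ge> 0"
      using ev by (auto simp: eventually_nhds_metric)
    have nk: "norm k + 1 > 0" by (simp add: add_nonneg_pos)
    then have "min (min d1 d2) (e / (norm k + 1)) > 0" using d1(1) d2(1) e(1) by simp
    then obtain t where "0 < t" "t < min (min d1 d2) (e / (norm k + 1))" using dense by blast
    then have t: "0 < t" "t < d1" "t < d2" "t < e / (norm k + 1)"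
by auto
    then have "t * (norm k + 1) < e" using nk by (simp add: pos_less_divide_eq)
    then have "dist (x + t *\<^sub>R k) x < e" using t(1) by (simp add: dist_norm algebra_simps)
    then show False using e(2) d1(2) d2(2) t by force
  qed
  then have "u \<bullet> h \<ge> \<epsilon> * (u \<bullet> u)" by (simp add: k_def inner_diff_right)
  moreover have "\<epsilon> * (u \<bullet> u) > 0" using \<epsilon> u by simp
  ultimately show ?thesis by linarith
qed

text \<open>The normal comes from a defining function that is only \<open>C\<^sup>1\<close>, whereas the barrier needs a smoother
one. Both are positive exactly on the same side of the boundary, so their gradients point to the
same open half space.\<close>

lemma grad_defining_function_pos:
  assumes \<rho>: "local_defining_function 3 \<Omega> U \<rho>" and x: "x \<in> U" "x \<in> frontier \<Omega>"
    and \<nu>: "outward_unit_normal \<Omega> x \<nu>" and h: "\<nu> \<bullet> h > 0"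
  shows "grad \<rho> x \<bullet> h > 0"
proof -
  obtain U' \<rho>' v where U': "x \<in> U'" and \<rho>': "local_defining_function 1 \<Omega> U' \<rho>'"
    and v: "(\<rho>' has_derivative (\<lambda>h. v \<bullet> h)) (at x)" and \<nu>v: "\<nu> = v /\<^sub>R norm v"
    using \<nu> unfolding outward_unit_normal_def by blast
  have vh: "v \<bullet> h > 0"
  proof -
    have "0 < inverse (norm v) * (v \<bullet> h)" using h unfolding \<nu>v by simp
    then show ?thesis by (simp add: zero_less_mult_iff)
  qed
  have "\<rho> differentiable (at x)"
    using \<rho> x by (simp add: local_defining_function_def numeral_3_eq_3)
  then have D: "(\<rho> has_derivative (\<lambda>h. grad \<rho> x \<bullet> h)) (at x)" by (rule has_derivative_grad)
  have "grad \<rho> x \<noteq> 0"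
  proof
    assume "grad \<rho> x = 0"
    then have "frechet_derivative \<rho> (at x) = (\<lambda>h. 0)" using frechet_derivative_at[OF D] by simp
    then show False using \<rho> x by (auto simp: local_defining_function_def)
  qed
  moreover have "\<forall>\<^sub>F y in nhds x. y \<in> U \<inter> U'"
    using \<rho> \<rho>' x(1) U' by (intro eventually_nhds_in_open) (auto simp: local_defining_function_def)
  then have "\<forall>\<^sub>F y in nhds x. \<rho>' y > 0 \<longrightarrow> \<rho> y \<ge> 0"
  proof (rule eventually_mono)
    fix y assume y: "y \<in> U \<inter> U'"
    show "\<rho>' y > 0 \<longrightarrow> \<rho> y \<ge> 0"
    proof
      assume "\<rho>' y > 0"
      then have "y \<notin> {z \<in> U'. \<rho>' z < 0}" by simp
      then have "y \<notin> \<Omega>" using \<rho>' y unfolding local_defining_function_def by blast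
      then show "\<rho> y \<ge> 0" using \<rho> y by (auto simp: local_defining_function_def not_less)
    qed
  qed
  moreover have "\<rho> x = 0" "\<rho>' x = 0"
    using \<rho> \<rho>' x U' by (auto simp: local_defining_function_def)
  ultimately show ?thesis using gradient_cone_inclusion[OF D _ v _ _ _ vh] by blast
qed

text \<open>The last condition, which carries the quantitative information, is restricted to a region \<open>V\<close> so
that barriers can be built locally: since the directional derivatives are nonnegative everywhere on
the boundary, the sum of barriers for \<open>V\<close> and \<open>V'\<close> is a barrier for \<open>V \<union> V'\<close>.\<close>

definition oblique_barrier ::
    "'a::euclidean_space set \<Rightarrow> 'b set \<Rightarrow> ('a \<Rightarrow> 'b \<Rightarrow> 'a) \<Rightarrow> 'a set \<Rightarrow> real \<Rightarrow>
     ('a \<Rightarrow> real) \<Rightarrow> ('a \<Rightarrow> 'a) \<Rightarrow> bool" where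
  "oblique_barrier \<Omega> B \<gamma> V K w G \<longleftrightarrow>
     C11_on UNIV K w G \<and>
     (\<forall>x\<in>frontier \<Omega>. w x = 0) \<and> (\<forall>x. x \<notin> \<Omega> \<longrightarrow> 0 \<le> w x) \<and>
     (\<forall>x\<in>frontier \<Omega>. \<forall>b\<in>B. 0 \<le> G x \<bullet> \<gamma> x b) \<and>
     (\<forall>x\<in>frontier \<Omega> \<inter> V. \<forall>b\<in>B. 1 \<le> G x \<bullet> \<gamma> x b)"

lemma compact_pos_lower_bound:
  fixes f :: "'a::topological_space \<Rightarrow> real"
  assumes "compact Z" "continuous_on Z f" "\<And>z. z \<in> Z \<Longrightarrow> f z > 0"
  shows "\<exists>\<eta>>0. \<forall>z\<in>Z. \<eta> \<le> f z"
proof (cases "Z = {}")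
  case True then show ?thesis by (auto intro: exI[of _ 1])
next
  case False
  from continuous_attains_inf[OF assms(1) False assms(2)] show ?thesis using assms(3) by blast
qed

text \<open>The barrier is a multiple of a bump times a defining function \<open>\<rho>\<close>. On the boundary \<open>\<rho> = 0\<close>, so the
gradient of the product is the bump times \<open>grad \<rho>\<close>, whose inner product with the reflection
directions is positive, and bounded below by compactness. On the ball of half the radius the bump is bounded below as
well, and scaling turns the lower bound into \<open>1\<close>.\<close>

lemma local_oblique_barrier:
  fixes \<Omega> :: "'a::euclidean_space set" and \<gamma> :: "'a \<Rightarrow> 'b::metric_space \<Rightarrow> 'a"
  assumes bc: "boundary_of_class 3 \<Omega>"
    and n: "\<And>x. x \<in> frontier \<Omega> \<Longrightarrow> outward_unit_normal \<Omega> x (n x)"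
    and B: "compact B" and \<gamma>: "continuous_on (frontier \<Omega> \<times> B) (\<lambda>(x, b). \<gamma> x b)"
    and pos: "\<And>x b. x \<in> frontier \<Omega> \<Longrightarrow> b \<in> B \<Longrightarrow> n x \<bullet> \<gamma> x b > 0"
    and x0: "x0 \<in> frontier \<Omega>"
  shows "\<exists>r>0. \<exists>K w G. oblique_barrier \<Omega> B \<gamma> (ball x0 r) K w G"
proof -
  obtain U \<rho> where U: "x0 \<in> U" and \<rho>: "local_defining_function 3 \<Omega> U \<rho>"
    using bc x0 by (auto simp: boundary_of_class_def)
  have "open U" and C3: "Ck_on 3 \<rho> U" using \<rho> by (auto simp: local_defining_function_def)
  then obtain r0 where r0: "r0 > 0" "cball x0 r0 \<subseteq> U" using U open_contains_cball by blast
  define r where "r = min r0 1"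
  have r: "0 < r" "r \<le> 1" using r0 by (auto simp: r_def)
  have rU: "cball x0 r \<subseteq> U" using r0 by (auto simp: r_def)
  have C2: "Ck_on 2 \<rho> U" using Ck_on_Suc_imp[of 2 \<rho> U] C3 by (simp add: numeral_3_eq_3 numeral_2_eq_2)
  obtain K1 where K1: "C11_on (cball x0 r) K1 \<rho> (grad \<rho>)"
    using Ck_on_2_imp_C11_on[OF C2 _ _ rU] by auto
  note D = C11_onD[OF K1]
  have K10: "0 \<le> K1" using K1 by (simp add: C11_on_def)
  define \<beta> where "\<beta> x = (r\<^sup>2 - (norm (x - x0))\<^sup>2)\<^sup>2" for x
  define H where "H x = (- 4 * (r\<^sup>2 - (norm (x - x0))\<^sup>2)) *\<^sub>R (x - x0)" for x
  define w1 where "w1 x = \<beta> x * \<rho> x" for x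
  define G1 where "G1 x = \<beta> x *\<^sub>R grad \<rho> x + \<rho> x *\<^sub>R H x" for x
  have C1: "C11_on (cball x0 r) (3 * (18 * K1)) w1 G1"
    unfolding w1_def[abs_def] G1_def[abs_def] \<beta>_def H_def
    by (rule C11_on_mult[OF C11_bump[OF r] K1])
  have bnd: "0 \<le> s" "s \<le> 1" "r\<^sup>2 - (norm (x - x0))\<^sup>2 \<le> 2 * s" "0 \<le> r\<^sup>2 - (norm (x - x0))\<^sup>2"
      "\<beta> x \<le> 4 * s\<^sup>2" "0 \<le> \<beta> x" "norm (H x) \<le> 8 * s"
    if x: "x \<in> cball x0 r" and s: "s = r - norm (x - x0)" for x s
  proof -
    have n: "norm (x - x0) \<le> r" using x by (simp add: dist_norm norm_minus_commute)
    show s01: "0 \<le> s" "s \<le> 1" using n r s norm_ge_zero[of "x - x0"] by linarith+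
    have f: "r\<^sup>2 - (norm (x - x0))\<^sup>2 = (r + norm (x - x0)) * s"
      by (simp add: s power2_eq_square algebra_simps)
    show le: "r\<^sup>2 - (norm (x - x0))\<^sup>2 \<le> 2 * s"
      unfolding f using s01 n r by (intro mult_right_mono) auto
    show ge: "0 \<le> r\<^sup>2 - (norm (x - x0))\<^sup>2" unfolding f using s01 r by simp
    show "0 \<le> \<beta> x" by (simp add: \<beta>_def)
    show "\<beta> x \<le> 4 * s\<^sup>2" unfolding \<beta>_def using power_mono[OF le ge, of 2] by (simp add: power_mult_distrib)
    have "norm (H x) = 4 * (r\<^sup>2 - (norm (x - x0))\<^sup>2) * norm (x - x0)"
      unfolding H_def using ge by simp
    also have "\<dots> \<le> (4 * (2 * s)) * 1"
      using le ge n r s01 by (intro mult_mono) auto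
    finally show "norm (H x) \<le> 8 * s" by simp
  qed
  define w where "w x = (if x \<in> cball x0 r then w1 x else 0)" for x
  define G where "G x = (if x \<in> cball x0 r then G1 x else 0)" for x
  have "C11_on UNIV (3 * (18 * K1) + 2 * (12 * K1)) w G"
    unfolding w_def[abs_def] G_def[abs_def]
  proof (rule C11_on_extend_by_zero[OF C1])
    fix x assume x: "x \<in> cball x0 r"
    define s where "s = r - norm (x - x0)"
    note b = bnd[OF x s_def]
    have "\<bar>w1 x\<bar> \<le> (4 * s\<^sup>2) * K1"
      unfolding w1_def abs_mult using b D(2)[OF x] by (intro mult_mono) auto
    moreover have "(4 * s\<^sup>2) * K1 \<le> 12 * K1 * s\<^sup>2" using K10 by simp
    ultimately show "\<bar>w1 x\<bar> \<le> 12 * K1 * (r - norm (x - x0))\<^sup>2" unfolding s_def by linarith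
    have "s\<^sup>2 \<le> s" using b by (simp add: power2_eq_square mult_left_le_one_le)
    then have "\<beta> x \<le> 4 * s" using b by linarith
    then have "norm (\<beta> x *\<^sub>R grad \<rho> x) \<le> (4 * s) * K1"
      unfolding norm_scaleR using b D(3)[OF x] by (intro mult_mono) auto
    moreover have "norm (\<rho> x *\<^sub>R H x) \<le> K1 * (8 * s)"
      unfolding norm_scaleR using b D(2)[OF x] K10 by (intro mult_mono) auto
    ultimately show "norm (G1 x) \<le> 12 * K1 * (r - norm (x - x0))"
      unfolding G1_def s_def[symmetric]
      using norm_triangle_ineq[of "\<beta> x *\<^sub>R grad \<rho> x" "\<rho> x *\<^sub>R H x"] by (simp add: algebra_simps)
  qed (use r K10 in auto)
  then have CwG: "C11_on UNIV (78 * K1) w G" by simp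
  have \<rho>0: "\<rho> x = 0" if "x \<in> frontier \<Omega>" "x \<in> cball x0 r" for x
    using that \<rho> rU by (auto simp: local_defining_function_def)
  have w0: "w x = 0" if "x \<in> frontier \<Omega>" for x
    using \<rho>0[OF that] by (simp add: w_def w1_def)
  have wpos: "w x \<ge> 0" if "x \<notin> \<Omega>" for x
  proof (cases "x \<in> cball x0 r")
    case True
    then have "x \<in> U" using rU by blast
    moreover have "x \<notin> {z \<in> U. \<rho> z < 0}"
      using that \<rho> by (simp add: local_defining_function_def) blast
    ultimately have "\<rho> x \<ge> 0" by simp
    then show ?thesis using True by (simp add: w_def w1_def \<beta>_def)
  qed (simp add: w_def)
  have gp: "grad \<rho> x \<bullet> \<gamma> x b > 0" if "x \<in> frontier \<Omega>" "x \<in> cball x0 r" "b \<in> B" for x b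
    using grad_defining_function_pos[OF \<rho> _ that(1) n[OF that(1)] pos[OF that(1,3)]] that(2) rU by blast
  have Geq: "G x \<bullet> \<gamma> x b = \<beta> x * (grad \<rho> x \<bullet> \<gamma> x b)" if "x \<in> frontier \<Omega>" "x \<in> cball x0 r" for x b
    using \<rho>0[OF that] that by (simp add: G_def G1_def)
  have Gnn: "0 \<le> G x \<bullet> \<gamma> x b" if "x \<in> frontier \<Omega>" "b \<in> B" for x b
  proof (cases "x \<in> cball x0 r")
    case True
    then show ?thesis using Geq[OF that(1) True] gp[OF that(1) True that(2)] by (simp add: \<beta>_def)
  qed (simp add: G_def)
  define Z where "Z = (frontier \<Omega> \<inter> cball x0 r) \<times> B"
  have "compact Z" unfolding Z_def
    by (intro compact_Times B closed_Int_compact) auto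
  moreover have "continuous_on Z (\<lambda>z. grad \<rho> (fst z) \<bullet> \<gamma> (fst z) (snd z))"
  proof -
    have "Ck_on 2 (\<lambda>x. frechet_derivative \<rho> (at x) i) U" for i
      using C3 by (simp add: numeral_3_eq_3 numeral_2_eq_2)
    then have "continuous_on U (grad \<rho>)"
      unfolding grad_def by (intro continuous_intros Ck_on_imp_continuous)
    then have "continuous_on Z (\<lambda>z. grad \<rho> (fst z))"
      by (rule continuous_on_compose2) (use rU in \<open>auto simp: Z_def intro!: continuous_intros\<close>)
    moreover have "continuous_on Z (\<lambda>z. \<gamma> (fst z) (snd z))"
      using continuous_on_subset[OF \<gamma>, of Z] by (auto simp: Z_def case_prod_unfold)
    ultimately show ?thesis by (intro continuous_intros)
  qed
  ultimately obtain \<eta> where \<eta>: "\<eta> > 0" "\<And>z. z \<in> Z \<Longrightarrow> \<eta> \<le> grad \<rho> (fst z) \<bullet> \<gamma> (fst z) (snd z)"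
    using compact_pos_lower_bound[of Z "\<lambda>z. grad \<rho> (fst z) \<bullet> \<gamma> (fst z) (snd z)"] gp
    unfolding Z_def by force
  \<comment> \<open>the value of the bump on the sphere of radius \<open>r/2\<close>\<close>
  define c where "c = (r\<^sup>2 - (r/2)\<^sup>2)\<^sup>2"
  have cpos: "c > 0" unfolding c_def using r by (simp add: power2_eq_square)
  have G1: "c * \<eta> \<le> G x \<bullet> \<gamma> x b" if x: "x \<in> frontier \<Omega> \<inter> ball x0 (r/2)" and b: "b \<in> B" for x b
  proof -
    have xr: "x \<in> cball x0 r" "norm (x - x0) \<le> r/2" using x r by (auto simp: dist_norm norm_minus_commute)
    have "(norm (x - x0))\<^sup>2 \<le> (r/2)\<^sup>2" using xr by (intro power_mono) auto
    then have "c \<le> \<beta> x" unfolding c_def \<beta>_def using r by (intro power_mono) (auto simp: power2_eq_square)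
    moreover have "\<eta> \<le> grad \<rho> x \<bullet> \<gamma> x b" using \<eta>(2)[of "(x, b)"] x xr b by (auto simp: Z_def)
    ultimately have "c * \<eta> \<le> \<beta> x * (grad \<rho> x \<bullet> \<gamma> x b)" using cpos \<eta>(1) by (intro mult_mono) auto
    then show ?thesis using Geq x xr by simp
  qed
  define q where "q = 1 / (c * \<eta>)"
  have q: "q > 0" "q * (c * \<eta>) = 1" using cpos \<eta>(1) by (auto simp: q_def)
  have "oblique_barrier \<Omega> B \<gamma> (ball x0 (r/2)) (q * (78 * K1)) (\<lambda>x. q * w x) (\<lambda>x. q *\<^sub>R G x)"
    unfolding oblique_barrier_def
  proof (intro conjI ballI allI impI)
    show "C11_on UNIV (q * (78 * K1)) (\<lambda>x. q * w x) (\<lambda>x. q *\<^sub>R G x)"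
      using C11_on_scale[OF CwG] q by simp
  next
    fix x b assume "x \<in> frontier \<Omega> \<inter> ball x0 (r/2)" "b \<in> B"
    then have "q * (c * \<eta>) \<le> q * (G x \<bullet> \<gamma> x b)" using G1 q by (intro mult_left_mono) auto
    then show "1 \<le> (q *\<^sub>R G x) \<bullet> \<gamma> x b" using q by simp
  qed (use q w0 wpos Gnn in auto)
  then show ?thesis using r by (intro exI[of _ "r/2"]) auto
qed

lemma ex_oblique_barrier:
  fixes \<Omega> :: "'a::euclidean_space set" and \<gamma> :: "'a \<Rightarrow> 'b::metric_space \<Rightarrow> 'a"
  assumes bd: "bounded \<Omega>" and bc: "boundary_of_class 3 \<Omega>"
    and n: "\<And>x. x \<in> frontier \<Omega> \<Longrightarrow> outward_unit_normal \<Omega> x (n x)"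
    and B: "compact B" and \<gamma>: "continuous_on (frontier \<Omega> \<times> B) (\<lambda>(x, b). \<gamma> x b)"
    and pos: "\<And>x b. x \<in> frontier \<Omega> \<Longrightarrow> b \<in> B \<Longrightarrow> n x \<bullet> \<gamma> x b > 0"
  shows "\<exists>K w G. oblique_barrier \<Omega> B \<gamma> UNIV K w G"
proof -
  have "\<exists>r. \<forall>x0\<in>frontier \<Omega>. 0 < r x0 \<and> (\<exists>K w G. oblique_barrier \<Omega> B \<gamma> (ball x0 (r x0)) K w G)"
    using local_oblique_barrier[OF bc n B \<gamma> pos] by (intro bchoice) blast
  then obtain r where r: "\<And>x0. x0 \<in> frontier \<Omega> \<Longrightarrow> 0 < r x0"
      "\<And>x0. x0 \<in> frontier \<Omega> \<Longrightarrow> \<exists>K w G. oblique_barrier \<Omega> B \<gamma> (ball x0 (r x0)) K w G"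
    by blast
  have "compact (frontier \<Omega>)" using bd by (rule compact_frontier_bounded)
  then obtain F where F: "F \<subseteq> frontier \<Omega>" "finite F" "frontier \<Omega> \<subseteq> (\<Union>x0\<in>F. ball x0 (r x0))"
    by (rule compactE_image[of "frontier \<Omega>" "frontier \<Omega>" "\<lambda>x0. ball x0 (r x0)"])
      (use r(1) in \<open>auto intro!: bexI centre_in_ball[THEN iffD2]\<close>)
  have "\<exists>K w G. oblique_barrier \<Omega> B \<gamma> (\<Union>x0\<in>F. ball x0 (r x0)) K w G" using F(2,1)
  proof (induction F)
    case empty
    have "oblique_barrier \<Omega> B \<gamma> {} 0 (\<lambda>x. 0) (\<lambda>x. 0)"
      by (auto simp: oblique_barrier_def C11_on_def)
    then show ?case by auto
  next
    case (insert a F)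
    then obtain K w G where 1: "oblique_barrier \<Omega> B \<gamma> (\<Union>x0\<in>F. ball x0 (r x0)) K w G" by auto
    obtain K' w' G' where 2: "oblique_barrier \<Omega> B \<gamma> (ball a (r a)) K' w' G'" using r(2) insert by blast
    have "oblique_barrier \<Omega> B \<gamma> (\<Union>x0\<in>insert a F. ball x0 (r x0)) (K + K')
        (\<lambda>x. w x + w' x) (\<lambda>x. G x + G' x)"
      unfolding oblique_barrier_def
    proof (intro conjI ballI allI impI)
      show "C11_on UNIV (K + K') (\<lambda>x. w x + w' x) (\<lambda>x. G x + G' x)"
        using 1 2 by (intro C11_on_add) (auto simp: oblique_barrier_def)
    next
      fix x b assume x: "x \<in> frontier \<Omega> \<inter> (\<Union>x0\<in>insert a F. ball x0 (r x0))" and b: "b \<in> B"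
      have "0 \<le> G x \<bullet> \<gamma> x b" "0 \<le> G' x \<bullet> \<gamma> x b"
        using 1 2 x b unfolding oblique_barrier_def by blast+
      moreover have "1 \<le> G x \<bullet> \<gamma> x b \<or> 1 \<le> G' x \<bullet> \<gamma> x b"
        using 1 2 x b unfolding oblique_barrier_def by blast
      ultimately show "1 \<le> (G x + G' x) \<bullet> \<gamma> x b" by (auto simp: inner_add_left)
    qed (use 1 2 in \<open>auto simp: oblique_barrier_def inner_add_left\<close>)
    then show ?case by blast
  qed
  then show ?thesis using F(3) unfolding oblique_barrier_def by blast
qed

section \<open>The oblique distance near the boundary\<close>

lemma C1_on_set_imp_lipschitz_near:
  fixes f :: "'a::euclidean_space \<Rightarrow> 'b::real_normed_vector"
  assumes f: "C1_on_set f S" and z: "z \<in> S"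
  shows "\<exists>r>0. \<exists>L\<ge>0. \<forall>x\<in>S \<inter> cball z r. \<forall>y\<in>S \<inter> cball z r. norm (f x - f y) \<le> L * norm (x - y)"
proof -
  from f[unfolded C1_on_set_def, rule_format, OF z]
  obtain U F where U: "open U" "z \<in> U" and F: "Ck_on 1 F U" "\<forall>x\<in>S \<inter> U. F x = f x" by metis
  obtain r where r: "r > 0" "cball z r \<subseteq> U" using U open_contains_cball by blast
  obtain L where "L \<ge> 0" "\<And>x y. x \<in> cball z r \<Longrightarrow> y \<in> cball z r \<Longrightarrow> norm (F x - F y) \<le> L * norm (x - y)"
    using Ck_on_1_imp_lipschitz[OF F(1) _ _ r(2)] by auto
  moreover have "F x = f x" if "x \<in> S \<inter> cball z r" for x using F(2) that r(2) by blast
  ultimately show ?thesis using r(1) by (metis IntD2)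
qed

lemma C1_on_set_imp_continuous_on:
  fixes f :: "'a::euclidean_space \<Rightarrow> 'b::real_normed_vector"
  assumes "C1_on_set f S"
  shows "continuous_on S f"
  unfolding continuous_on_eq_continuous_within
proof
  fix z assume z: "z \<in> S"
  from assms[unfolded C1_on_set_def, rule_format, OF z]
  obtain U F where U: "open U" "z \<in> U" and F: "Ck_on 1 F U" "\<forall>x\<in>S \<inter> U. F x = f x" by metis
  have "continuous_on U F" using Ck_on_imp_continuous[OF F(1)] .
  then have "continuous (at z within S \<inter> U) F"
    using U by (auto simp: continuous_on_eq_continuous_at intro: continuous_at_imp_continuous_at_within)
  then have "continuous (at z within S \<inter> U) f"
    by (rule continuous_transform_within[where \<delta> = 1]) (use F(2) z U in auto)
  then show "continuous (at z within S) f"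
    using at_within_nhd[OF U(2,1), of "S \<inter> U" S] unfolding continuous_within by (simp add: Int_assoc)
qed

text \<open>The local Lipschitz constants are summed over a finite cover of \<open>T\<close> by balls of half the radius on
which they hold; the other half leaves room for the point of \<open>S\<close> that is compared with \<open>z\<close>.\<close>

lemma C1_on_set_lipschitz_near_compact:
  fixes f :: "'a::euclidean_space \<Rightarrow> 'b::real_normed_vector"
  assumes f: "C1_on_set f S" and T: "compact T" "T \<subseteq> S"
  shows "\<exists>e>0. \<exists>L\<ge>0. \<forall>z\<in>T. \<forall>x\<in>S. dist x z < e \<longrightarrow> norm (f x - f z) \<le> L * dist x z"
proof -
  have "\<forall>z\<in>T. \<exists>r L. r > 0 \<and> L \<ge> 0 \<and> (\<forall>x\<in>S \<inter> cball z r. \<forall>y\<in>S \<inter> cball z r.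
      norm (f x - f y) \<le> L * norm (x - y))"
    using C1_on_set_imp_lipschitz_near[OF f] T(2) by blast
  then obtain r L where rL: "\<And>z. z \<in> T \<Longrightarrow> r z > 0" "\<And>z. z \<in> T \<Longrightarrow> L z \<ge> 0"
      "\<And>z x y. z \<in> T \<Longrightarrow> x \<in> S \<inter> cball z (r z) \<Longrightarrow> y \<in> S \<inter> cball z (r z) \<Longrightarrow>
      norm (f x - f y) \<le> L z * norm (x - y)"
    by metis
  obtain F where F: "F \<subseteq> T" "finite F" "T \<subseteq> (\<Union>z\<in>F. ball z (r z / 2))"
    by (rule compactE_image[OF T(1), of T "\<lambda>z. ball z (r z / 2)"])
      (use rL(1) in \<open>auto intro!: bexI centre_in_ball[THEN iffD2]\<close>)
  define e where "e = Min (insert 1 ((\<lambda>z. r z / 2) ` F))"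
  have e: "e > 0" using F(1,2) rL(1) by (auto simp: e_def)
  have e_le: "e \<le> r z / 2" if "z \<in> F" for z
    unfolding e_def using F(2) that by (intro Min_le) auto
  have L0: "(\<Sum>z\<in>F. L z) \<ge> 0" using F(1) rL(2) by (auto intro: sum_nonneg)
  have "norm (f x - f z) \<le> (\<Sum>z\<in>F. L z) * dist x z" if z: "z \<in> T" and x: "x \<in> S" "dist x z < e" for x z
  proof -
    obtain a where a: "a \<in> F" "dist a z < r a / 2" using F(3) z by auto
    have aT: "a \<in> T" using a F by auto
    have "z \<in> S \<inter> cball a (r a)" using a z T(2) rL(1)[OF aT] by auto
    moreover have "dist a x \<le> r a"
      using dist_triangle[of a x z] a(2) x(2) e_le[OF a(1)] by (simp add: dist_commute)
    then have "x \<in> S \<inter> cball a (r a)" using x by auto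
    ultimately have "norm (f x - f z) \<le> L a * dist x z"
      using rL(3)[OF aT] by (simp add: dist_norm)
    also have "L a \<le> (\<Sum>z\<in>F. L z)" using member_le_sum[of a F L] a(1) F rL(2) by auto
    finally show ?thesis by (simp add: mult_right_mono)
  qed
  then show ?thesis using e L0 by blast
qed

lemma oblique_distance_lipschitz:
  fixes P :: "('n::finite, 'm::finite, 'a::finite, 'b::finite) problem"
  assumes op: "oblique_projection P R p d" and R: "R > 0"
    and bd: "bounded (dom P)" and B: "compact (ctrlB P)"
  shows "\<exists>e>0. \<exists>L\<ge>0. \<forall>q\<in>frontier (dom P). \<forall>b\<in>ctrlB P. \<forall>y\<in>tube (dom P) R.
           dist y q < e \<longrightarrow> \<bar>d y b\<bar> \<le> L * dist y q"
proof -
  have C1: "C1_on_set (\<lambda>(x, b). d x b) (tube (dom P) R \<times> ctrlB P)"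
    and d0: "\<And>x b. x \<in> frontier (dom P) \<Longrightarrow> b \<in> ctrlB P \<Longrightarrow> d x b = 0"
    using op by (auto simp: oblique_projection_def)
  have "frontier (dom P) \<subseteq> tube (dom P) R" using R by (auto simp: tube_def)
  then have sub: "frontier (dom P) \<times> ctrlB P \<subseteq> tube (dom P) R \<times> ctrlB P" by blast
  have "compact (frontier (dom P) \<times> ctrlB P)"
    using bd B by (intro compact_Times compact_frontier_bounded)
  from C1_on_set_lipschitz_near_compact[OF C1 this sub]
  obtain e L where e: "e > 0" "L \<ge> 0" and L: "\<And>z x. z \<in> frontier (dom P) \<times> ctrlB P \<Longrightarrow>
      x \<in> tube (dom P) R \<times> ctrlB P \<Longrightarrow> dist x z < e \<Longrightarrow>
      norm ((\<lambda>(x, b). d x b) x - (\<lambda>(x, b). d x b) z) \<le> L * dist x z"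
    by blast
  have "\<bar>d y b\<bar> \<le> L * dist y q" if "q \<in> frontier (dom P)" "b \<in> ctrlB P" "y \<in> tube (dom P) R"
      "dist y q < e" for q b y
  proof -
    have "dist (y, b) (q, b) = dist y q" by (simp add: dist_prod_def)
    then show ?thesis using L[of "(q, b)" "(y, b)"] that d0 by simp
  qed
  then show ?thesis using e by blast
qed

lemma exit_segment_meets_frontier:
  fixes x y :: "'a::real_normed_vector"
  assumes "x \<in> closure \<Omega>" "y \<notin> closure \<Omega>"
  shows "\<exists>q\<in>frontier \<Omega>. dist y q \<le> dist y x"
proof -
  have "closed_segment y x \<inter> frontier (closure \<Omega>) \<noteq> {}"
    using assms by (intro connected_Int_frontier) auto
  moreover have "frontier (closure \<Omega>) \<subseteq> frontier \<Omega>"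
    using closure_subset[of \<Omega>] by (auto simp: frontier_def dest: interior_mono[THEN subsetD])
  ultimately obtain q where q: "q \<in> closed_segment y x" "q \<in> frontier \<Omega>" by blast
  then show ?thesis using segment_bound1[OF q(1)] by (auto simp: dist_norm norm_minus_commute)
qed

text \<open>Both \<open>y\<close> and its reflected point lie on the line through \<open>q\<close> in the direction \<open>\<gamma> q b\<close>, so both
values of \<open>w\<close> are expanded at \<open>q\<close>, where \<open>w\<close> vanishes. The reflection lowers the first order term by
\<open>(\<delta> + e) * (G q \<bullet> \<gamma> q b)\<close>, which is at least \<open>\<delta> + e\<close>. If \<open>\<delta>\<close> were negative, the expansion and the
smallness of \<open>\<delta>\<close> would give \<open>w y < 0\<close>, which is impossible outside \<open>\<Omega>\<close>.\<close>

lemma barrier_reflection: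
  fixes \<Omega> :: "'a::euclidean_space set"
  assumes ob: "oblique_barrier \<Omega> B \<gamma> UNIV K w G" and q: "q \<in> frontier \<Omega>" and b: "b \<in> B"
    and \<gamma>: "norm (\<gamma> q b) = 1" and y: "y = q + \<delta> *\<^sub>R \<gamma> q b" "y \<notin> closure \<Omega>"
    and small: "K * \<bar>\<delta>\<bar> < 1" and e: "e \<ge> 0"
  shows "0 \<le> \<delta>" "w (q - e *\<^sub>R \<gamma> q b) + (\<delta> + e) \<le> w y + K * (\<delta>\<^sup>2 + e\<^sup>2)"
proof -
  have C: "C11_on UNIV K w G" and wq: "w q = 0" and wy: "0 \<le> w y" and g: "1 \<le> G q \<bullet> \<gamma> q b"
    using ob q b y closure_subset[of \<Omega>] unfolding oblique_barrier_def by blast+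
  note T = C11_onD(5)[OF C UNIV_I UNIV_I]
  have 1: "\<bar>w y - \<delta> * (G q \<bullet> \<gamma> q b)\<bar> \<le> K * \<delta>\<^sup>2"
    using T[of y q] \<gamma> by (simp add: y wq)
  have 2: "\<bar>w (q - e *\<^sub>R \<gamma> q b) + e * (G q \<bullet> \<gamma> q b)\<bar> \<le> K * e\<^sup>2"
    using T[of "q - e *\<^sub>R \<gamma> q b" q] \<gamma> by (simp add: wq)
  show \<delta>0: "0 \<le> \<delta>"
  proof (rule ccontr)
    assume "\<not> 0 \<le> \<delta>"
    then have \<delta>: "\<delta> < 0" by simp
    have "\<delta> * (G q \<bullet> \<gamma> q b) \<le> \<delta> * 1" using \<delta> g by (intro mult_left_mono_neg) auto
    moreover have "K * \<delta>\<^sup>2 = (K * \<bar>\<delta>\<bar>) * \<bar>\<delta>\<bar>" by (simp add: power2_eq_square)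
    moreover have "(K * \<bar>\<delta>\<bar>) * \<bar>\<delta>\<bar> < 1 * \<bar>\<delta>\<bar>" using \<delta> small by (intro mult_strict_right_mono) auto
    ultimately show False using 1 wy \<delta> by linarith
  qed
  have "(\<delta> + e) * 1 \<le> (\<delta> + e) * (G q \<bullet> \<gamma> q b)" using \<delta>0 e g by (intro mult_left_mono) auto
  then show "w (q - e *\<^sub>R \<gamma> q b) + (\<delta> + e) \<le> w y + K * (\<delta>\<^sup>2 + e\<^sup>2)"
    using 1 2 by (simp add: distrib_left distrib_right)
qed

section \<open>Averages over the branches\<close>

lemma sum_branches:
  "(\<Sum>s\<in>branches. F s) = (\<Sum>j\<in>UNIV. F (1, j) + F (- 1, j :: 'm::finite) :: real)"
  by (simp add: sum.distrib sum.cartesian_product')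

text \<open>The two signs of each column cancel to first order, so only the drift \<open>z\<close> and the quadratic
remainders are left; with \<open>h\<close> of order \<open>sqrt dt\<close> all of this is of order \<open>dt\<close>.\<close>

lemma branch_average_le:
  fixes v :: "'m::finite \<Rightarrow> 'a::euclidean_space"
  assumes C: "C11_on UNIV K w G" and h: "h \<ge> 0" and v: "\<And>j. norm (v j) \<le> V"
  shows "(\<Sum>s\<in>branches. w (x + z + (fst s * h) *\<^sub>R v (snd s)))
     \<le> 2 * real CARD('m) * (w x + (K * norm z + K * (norm z + h * V)\<^sup>2))"
proof -
  note D = C11_onD[OF C UNIV_I]
  have K: "0 \<le> K" using C by (simp add: C11_on_def)
  have one: "w (x + z + (t * h) *\<^sub>R v j) \<le> w x + (G x \<bullet> z + t * h * (G x \<bullet> v j)) + K * (norm z + h * V)\<^sup>2"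
    if "\<bar>t\<bar> = 1" for t j
  proof -
    have "\<bar>w (x + z + (t * h) *\<^sub>R v j) - w x - G x \<bullet> (z + (t * h) *\<^sub>R v j)\<bar>
        \<le> K * (norm (z + (t * h) *\<^sub>R v j))\<^sup>2"
      using D(5)[of "x + z + (t * h) *\<^sub>R v j" x] by (simp add: add.assoc)
    moreover have "norm ((t * h) *\<^sub>R v j) \<le> h * V"
      using h v[of j] that by (simp add: abs_mult mult_left_mono)
    then have "norm (z + (t * h) *\<^sub>R v j) \<le> norm z + h * V"
      using norm_triangle_ineq[of z "(t * h) *\<^sub>R v j"] by linarith
    then have "K * (norm (z + (t * h) *\<^sub>R v j))\<^sup>2 \<le> K * (norm z + h * V)\<^sup>2"
      using K by (intro mult_left_mono power_mono) auto
    ultimately show ?thesis by (simp add: inner_add_right)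
  qed
  have "(\<Sum>s\<in>branches. w (x + z + (fst s * h) *\<^sub>R v (snd s)))
     \<le> (\<Sum>j\<in>(UNIV::'m set). 2 * (w x + G x \<bullet> z + K * (norm z + h * V)\<^sup>2))"
    unfolding sum_branches
  proof (rule sum_mono)
    fix j
    show "w (x + z + (fst (1, j) * h) *\<^sub>R v (snd (1, j))) + w (x + z + (fst (- 1, j) * h) *\<^sub>R v (snd (- 1, j)))
      \<le> 2 * (w x + G x \<bullet> z + K * (norm z + h * V)\<^sup>2)"
      using one[of 1 j] one[of "-1" j] by simp
  qed
  also have "\<dots> = 2 * real CARD('m) * (w x + (G x \<bullet> z + K * (norm z + h * V)\<^sup>2))" by simp
  also have "\<dots> \<le> 2 * real CARD('m) * (w x + (K * norm z + K * (norm z + h * V)\<^sup>2))"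
  proof -
    have "G x \<bullet> z \<le> norm (G x) * norm z" by (rule norm_cauchy_schwarz)
    also have "\<dots> \<le> K * norm z" using D(3) by (intro mult_right_mono) auto
    finally show ?thesis by (intro mult_left_mono) auto
  qed
  finally show ?thesis .
qed

section \<open>Interpolation on the mesh\<close>

text \<open>On a simplex with vertex set \<open>C\<close> the basis functions of the vertices in \<open>C\<close> are its barycentric
coordinates and all others vanish: an affine function on the simplex is determined by its values on
\<open>C\<close>.\<close>

lemma P1_barycentric:
  fixes m :: "'n::finite mesh"
  assumes sm: "straight_mesh \<Omega> \<delta> dx m" and P1: "P1_basis m" and K: "K \<in> elems m" and z: "z \<in> K"
  shows "\<And>i. i \<in> {1..nvert m} \<Longrightarrow> 0 \<le> hat m i z"
    and "(\<Sum>i=1..nvert m. hat m i z) = 1"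
    and "(\<Sum>i=1..nvert m. hat m i z *\<^sub>R vtx m i) = z"
    and "\<And>i. i \<in> {1..nvert m} \<Longrightarrow> hat m i z \<noteq> 0 \<Longrightarrow> vtx m i \<in> K"
proof -
  let ?I = "{1..nvert m}"
  have "int CARD('n) simplex K" using sm K by (simp add: straight_mesh_def)
  then obtain C where C: "\<not> affine_dependent C" "K = convex hull C" unfolding simplex by blast
  have fin: "finite C" using C(1) aff_independent_finite by blast
  have CK: "C \<subseteq> K" using hull_subset[of C convex] C(2) by simp
  have "verts K = C" using C by (auto simp: verts_def extreme_point_of_convex_hull_affine_independent)
  moreover have "vtx m ` ?I = (\<Union>K\<in>elems m. verts K)" using sm by (simp add: straight_mesh_def)
  ultimately have sub: "C \<subseteq> vtx m ` ?I" using K by blast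
  have inj: "inj_on (vtx m) ?I" using sm by (simp add: straight_mesh_def)
  obtain u where u: "\<And>v. v \<in> C \<Longrightarrow> 0 \<le> u v" "sum u C = 1" "(\<Sum>v\<in>C. u v *\<^sub>R v) = z"
    using z C(2) convex_hull_finite[OF fin] by auto
  define J where "J = {i \<in> ?I. vtx m i \<in> C}"
  have bij: "bij_betw (vtx m) J C"
    unfolding bij_betw_def
  proof
    show "inj_on (vtx m) J" using inj by (rule inj_on_subset) (auto simp: J_def)
    show "vtx m ` J = C" using sub unfolding J_def by blast
  qed
  have hat: "hat m i z = (if vtx m i \<in> C then u (vtx m i) else 0)" if i: "i \<in> ?I" for i
  proof -
    have Pi: "(\<forall>K\<in>elems m. \<exists>c v. \<forall>x\<in>K. hat m i x = c + v \<bullet> x) \<and>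
        (\<forall>j\<in>?I. hat m i (vtx m j) = (if i = j then 1 else 0))"
      using P1[unfolded P1_basis_def, THEN bspec, OF i] by (rule conjunct2)
    then obtain c a where "\<forall>x\<in>K. hat m i x = c + a \<bullet> x" using K by meson
    then have ca: "\<And>x. x \<in> K \<Longrightarrow> hat m i x = c + a \<bullet> x" by simp
    have vert: "hat m i v = (if v = vtx m i then 1 else 0)" if v: "v \<in> C" for v
    proof -
      obtain j where j: "j \<in> ?I" "v = vtx m j" using v sub by blast
      have "hat m i v = (if i = j then 1 else 0)" using Pi j by simp
      then show ?thesis using inj_on_eq_iff[OF inj j(1) i] j(2) by auto
    qed
    have "hat m i z = c + a \<bullet> (\<Sum>v\<in>C. u v *\<^sub>R v)" using ca[OF z] u(3) by simp
    also have "\<dots> = (\<Sum>v\<in>C. u v * (c + a \<bullet> v))"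
      using u(2) by (simp add: inner_sum_right distrib_left sum.distrib flip: sum_distrib_right)
    also have "\<dots> = (\<Sum>v\<in>C. if v = vtx m i then u v else 0)"
      using vert ca CK by (intro sum.cong) (auto simp: subset_iff)
    also have "\<dots> = (if vtx m i \<in> C then u (vtx m i) else 0)" using fin by simp
    finally show ?thesis .
  qed
  show "0 \<le> hat m i z" if "i \<in> ?I" for i using hat[OF that] u(1) by simp
  show "vtx m i \<in> K" if "i \<in> ?I" "hat m i z \<noteq> 0" for i
    using hat[OF that(1)] that(2) CK by (auto split: if_splits)
  have "(\<Sum>i\<in>?I. hat m i z) = (\<Sum>i\<in>J. u (vtx m i))"
    unfolding J_def by (subst sum.inter_filter) (auto intro!: sum.cong simp: hat)
  also have "\<dots> = sum u C" by (rule sum.reindex_bij_betw[OF bij])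
  finally show "(\<Sum>i\<in>?I. hat m i z) = 1" using u(2) by simp
  have "(\<Sum>i\<in>?I. hat m i z *\<^sub>R vtx m i) = (\<Sum>i\<in>J. u (vtx m i) *\<^sub>R vtx m i)"
    unfolding J_def by (subst sum.inter_filter) (auto intro!: sum.cong simp: hat)
  also have "\<dots> = (\<Sum>v\<in>C. u v *\<^sub>R v)" by (rule sum.reindex_bij_betw[OF bij])
  finally show "(\<Sum>i\<in>?I. hat m i z *\<^sub>R vtx m i) = z" using u(3) by simp
qed

lemma straight_mesh_elem:
  fixes m :: "'n::finite mesh"
  assumes sm: "straight_mesh \<Omega> \<delta> dx m" and K: "K \<in> elems m"
  shows "compact K" "K \<noteq> {}" "\<And>x y. x \<in> K \<Longrightarrow> y \<in> K \<Longrightarrow> norm (x - y) \<le> dx"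
proof -
  have "int CARD('n) simplex K" using sm K by (simp add: straight_mesh_def)
  then obtain C where C: "\<not> affine_dependent C" "int (card C) = int CARD('n) + 1" "K = convex hull C"
    unfolding simplex by blast
  have fin: "finite C" using C(1) aff_independent_finite by blast
  show c: "compact K" using C(3) fin by (simp add: finite_imp_compact_convex_hull)
  show "K \<noteq> {}" using C(2,3) by auto
  fix x y assume "x \<in> K" "y \<in> K"
  then have "norm (x - y) \<le> diameter K"
    using diameter_bounded_bound[OF compact_imp_bounded[OF c]] by (simp add: dist_norm)
  also have "\<dots> \<le> dx"
  proof -
    have "dx = Max (diameter ` elems m)" "triangulation (elems m)" using sm by (simp_all add: straight_mesh_def)
    then show ?thesis using K by (simp add: triangulation_def)
  qed
  finally show "norm (x - y) \<le> dx" .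
qed

lemma mesh_projection_in_elem:
  assumes "straight_mesh \<Omega> \<delta> dx m" "mesh_projection \<Omega> m" "x \<in> closure \<Omega>"
  shows "\<exists>K\<in>elems m. proj m x \<in> K"
proof -
  obtain K where K: "K \<in> elems m" "proj m x = closest_point K x"
    using assms unfolding mesh_projection_def by blast
  then have "proj m x \<in> K"
    using straight_mesh_elem[OF assms(1) K(1)] by (simp add: closest_point_in_set compact_imp_closed)
  then show ?thesis using K(1) by blast
qed

text \<open>Barycentric coordinates reproduce affine functions, so at \<open>z = proj m x\<close> the error is the weighted
mean of the Taylor remainders from \<open>z\<close> to the vertices of its simplex, which are within distance
\<open>dx\<close>. Replacing \<open>z\<close> by \<open>x\<close> costs the Lipschitz constant times \<open>norm (x - z)\<close>.\<close>

lemma interp_error_C11: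
  assumes sm: "straight_mesh \<Omega> \<delta> dx m" and mp: "mesh_projection \<Omega> m" and P1: "P1_basis m"
    and C: "C11_on UNIV K w G" and x: "x \<in> closure \<Omega>" and px: "norm (x - proj m x) \<le> C' * dx\<^sup>2"
  shows "\<bar>interp m (\<lambda>i. w (vtx m i)) x - w x\<bar> \<le> K * (1 + C') * dx\<^sup>2"
proof -
  define z where "z = proj m x"
  obtain E where E: "E \<in> elems m" "z \<in> E" unfolding z_def using mesh_projection_in_elem[OF sm mp x] by blast
  note b = P1_barycentric[OF sm P1 E]
  let ?I = "{1..nvert m}"
  have K: "0 \<le> K" using C by (simp add: C11_on_def)
  have "interp m (\<lambda>i. w (vtx m i)) x - w z
      = (\<Sum>i\<in>?I. hat m i z * w (vtx m i)) - (\<Sum>i\<in>?I. hat m i z) * w z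
        - G z \<bullet> ((\<Sum>i\<in>?I. hat m i z *\<^sub>R vtx m i) - (\<Sum>i\<in>?I. hat m i z) *\<^sub>R z)"
    unfolding b(2,3) interp_def z_def[symmetric] by simp
  also have "\<dots> = (\<Sum>i\<in>?I. hat m i z * (w (vtx m i) - w z - G z \<bullet> (vtx m i - z)))"
    by (simp add: sum_distrib_right scaleR_sum_left inner_diff_right inner_sum_right
        right_diff_distrib sum_subtractf)
  finally have "\<bar>interp m (\<lambda>i. w (vtx m i)) x - w z\<bar>
      \<le> (\<Sum>i\<in>?I. \<bar>hat m i z * (w (vtx m i) - w z - G z \<bullet> (vtx m i - z))\<bar>)"
    by (simp only: sum_abs)
  also have "\<dots> \<le> (\<Sum>i\<in>?I. hat m i z * (K * dx\<^sup>2))"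
  proof (rule sum_mono)
    fix i assume i: "i \<in> ?I"
    show "\<bar>hat m i z * (w (vtx m i) - w z - G z \<bullet> (vtx m i - z))\<bar> \<le> hat m i z * (K * dx\<^sup>2)"
    proof (cases "hat m i z = 0")
      case False
      have "norm (vtx m i - z) \<le> dx"
        using straight_mesh_elem(3)[OF sm E(1) b(4)[OF i False] E(2)] .
      then have "K * (norm (vtx m i - z))\<^sup>2 \<le> K * dx\<^sup>2"
        using K by (intro mult_left_mono power_mono) auto
      then have "\<bar>w (vtx m i) - w z - G z \<bullet> (vtx m i - z)\<bar> \<le> K * dx\<^sup>2"
        using C11_onD(5)[OF C UNIV_I UNIV_I, of "vtx m i" z] by linarith
      then show ?thesis using b(1)[OF i] by (simp add: abs_mult mult_left_mono)
    qed simp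
  qed
  also have "\<dots> = K * dx\<^sup>2" using b(2) by (simp flip: sum_distrib_right)
  finally have 1: "\<bar>interp m (\<lambda>i. w (vtx m i)) x - w z\<bar> \<le> K * dx\<^sup>2" .
  have "\<bar>w z - w x\<bar> \<le> K * norm (z - x)" using C11_onD(4)[OF C UNIV_I UNIV_I] .
  also have "\<dots> \<le> K * (C' * dx\<^sup>2)" using K px unfolding z_def
    by (intro mult_left_mono) (auto simp: norm_minus_commute)
  finally show ?thesis using 1 by (simp add: algebra_simps)
qed

lemma interp_abs_le:
  assumes sm: "straight_mesh \<Omega> \<delta> dx m" and mp: "mesh_projection \<Omega> m" and P1: "P1_basis m"
    and x: "x \<in> closure \<Omega>"
    and \<phi>: "\<And>i. i \<in> {1..nvert m} \<Longrightarrow> \<bar>\<phi> i\<bar> \<le> A + M * \<omega> i"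
  shows "\<bar>interp m \<phi> x\<bar> \<le> A + M * interp m \<omega> x"
proof -
  define z where "z = proj m x"
  obtain E where E: "E \<in> elems m" "z \<in> E" unfolding z_def using mesh_projection_in_elem[OF sm mp x] by blast
  note b = P1_barycentric[OF sm P1 E]
  have "\<bar>interp m \<phi> x\<bar> \<le> (\<Sum>i=1..nvert m. \<bar>hat m i z * \<phi> i\<bar>)"
    unfolding interp_def z_def[symmetric] by (rule sum_abs)
  also have "\<dots> \<le> (\<Sum>i=1..nvert m. hat m i z * (A + M * \<omega> i))"
    using b(1) \<phi> by (intro sum_mono) (simp add: abs_mult mult_left_mono)
  also have "\<dots> = (\<Sum>i=1..nvert m. hat m i z) * A + M * interp m \<omega> x"
    unfolding interp_def z_def[symmetric]
    by (simp add: distrib_left sum.distrib sum_distrib_left sum_distrib_right mult.left_commute)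
  finally show ?thesis using b(2) by simp
qed

text \<open>Each vertex is shared with the exact triangulation, whose elements fill the closed domain. This is
what makes the data bounds available at the vertices.\<close>

lemma vtx_in_closure:
  assumes sm: "straight_mesh \<Omega> \<delta> dx m" and ex: "exact_triangulation \<Omega> m" and i: "i \<in> {1..nvert m}"
  shows "vtx m i \<in> closure \<Omega>"
proof -
  have "vtx m ` {1..nvert m} = (\<Union>K\<in>elems m. verts K)" using sm by (simp add: straight_mesh_def)
  then have "vtx m i \<in> (\<Union>K\<in>elems m. verts K)" using i by blast
  then obtain K where K: "K \<in> elems m" "vtx m i \<in> verts K" by blast
  have "\<exists>h. (\<forall>K\<in>elems m. (\<exists>h'. homeomorphism K (curved m K) (h K) h') \<and> (\<forall>v\<in>verts K. h K v = v)) \<and>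
      (\<forall>K\<in>elems m. \<forall>K'\<in>elems m. curved m K \<inter> curved m K' = h K ` (K \<inter> K'))"
    using ex by (simp add: exact_triangulation_def)
  then obtain h where "\<forall>K\<in>elems m. (\<exists>h'. homeomorphism K (curved m K) (h K) h') \<and> (\<forall>v\<in>verts K. h K v = v)"
    by (elim exE conjE)
  from bspec[OF this K(1)] obtain h' where h': "homeomorphism K (curved m K) (h K) h'"
    and hv: "h K (vtx m i) = vtx m i"
    using K(2) by (elim exE conjE) (auto dest: bspec)
  have "vtx m i \<in> K" using K(2) by (simp add: verts_def extreme_point_of_def)
  then have "vtx m i \<in> curved m K" using homeomorphism_image1[OF h'] hv by force
  moreover have "closure \<Omega> = (\<Union>K\<in>elems m. curved m K)" using ex by (simp add: exact_triangulation_def)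
  ultimately show ?thesis using K(1) by blast
qed

section \<open>One step of the scheme\<close>

lemma norm_column_le: "norm (column j (A :: real^'m^'n)) \<le> norm A"
proof (rule norm_le_componentwise_cart)
  fix i
  show "norm (column j A $ i) \<le> norm (A $ i)"
    using component_le_norm_cart[of "A $ i" j] by (simp add: column_def)
qed

text \<open>Collects the errors of one step: \<open>E\<close> from the reflection, \<open>\<epsilon>\<close> from the interpolation, \<open>Q\<close> from the
branch average and \<open>dt\<close> from the running cost. The decisive point is that \<open>M * w\<close> at the reflected
point together with the boundary cost is at most \<open>M * (w y + E)\<close> at the point before reflection.\<close>

lemma Sab_abs_le:
  fixes P :: "('n::finite, 'm::finite, 'a::finite, 'b::finite) problem"
  assumes interp: "\<And>s. s \<in> branches \<Longrightarrow>
      \<bar>interp m \<Phi> (ytil P cbar p m dt k i s a b)\<bar> \<le> A + M * (w (ytil P cbar p m dt k i s a b) + \<epsilon>)"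
    and refl: "\<And>s. s \<in> branches \<Longrightarrow> 0 \<le> dtil P cbar d m dt k i s a b \<and>
      w (ytil P cbar p m dt k i s a b) + dtil P cbar d m dt k i s a b \<le> w (ypt P m dt k i s a) + E"
    and g: "\<And>s. s \<in> branches \<Longrightarrow> \<bar>gtil P p m dt k i s a b\<bar> \<le> M"
    and avg: "(\<Sum>s\<in>branches. w (ypt P m dt k i s a)) \<le> 2 * real CARD('m) * (w (vtx m i) + Q)"
    and f: "\<bar>fcost P (real k * dt) (vtx m i) a\<bar> \<le> M"
    and M: "0 \<le> M" and dt: "0 \<le> dt"
  shows "\<bar>Sab P cbar p d m dt k i \<Phi> a b\<bar> \<le> A + M * w (vtx m i) + M * (Q + E + \<epsilon> + dt)"
proof -
  let ?y = "\<lambda>s. ypt P m dt k i s a"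
  let ?t = "\<lambda>s. interp m \<Phi> (ytil P cbar p m dt k i s a b)
     + dtil P cbar d m dt k i s a b * gtil P p m dt k i s a b"
  let ?N = "2 * real CARD('m)"
  have N: "?N > 0" by simp
  have t: "\<bar>?t s\<bar> \<le> (A + M * (E + \<epsilon>)) + M * w (?y s)" if s: "s \<in> branches" for s
  proof -
    have "\<bar>dtil P cbar d m dt k i s a b * gtil P p m dt k i s a b\<bar> \<le> dtil P cbar d m dt k i s a b * M"
      unfolding abs_mult using refl[OF s] g[OF s] by (intro mult_mono) auto
    then have "\<bar>?t s\<bar> \<le> A + M * (w (ytil P cbar p m dt k i s a b) + dtil P cbar d m dt k i s a b) + M * \<epsilon>"
      using interp[OF s] by (simp add: algebra_simps)
    also have "\<dots> \<le> A + M * (w (?y s) + E) + M * \<epsilon>"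
      using refl[OF s] M by (intro add_right_mono add_left_mono mult_left_mono) auto
    finally show ?thesis by (simp add: algebra_simps)
  qed
  have "\<bar>\<Sum>s\<in>branches. ?t s\<bar> \<le> (\<Sum>s\<in>branches. \<bar>?t s\<bar>)" by (rule sum_abs)
  also have "\<dots> \<le> (\<Sum>s\<in>(branches :: (real \<times> 'm) set). (A + M * (E + \<epsilon>)) + M * w (?y s))"
    using t by (rule sum_mono)
  also have "\<dots> = ?N * (A + M * (E + \<epsilon>)) + M * (\<Sum>s\<in>branches. w (?y s))"
    by (simp add: sum.distrib sum_distrib_left card_cartesian_product)
  also have "\<dots> \<le> ?N * (A + M * (E + \<epsilon>)) + M * (?N * (w (vtx m i) + Q))"
    using avg M by (intro add_left_mono mult_left_mono)
  also have "\<dots> = ?N * (A + M * (w (vtx m i) + Q + E + \<epsilon>))" by (simp add: algebra_simps)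
  finally have 1: "\<bar>\<Sum>s\<in>branches. ?t s\<bar> \<le> ?N * (A + M * (w (vtx m i) + Q + E + \<epsilon>))" .
  have "\<bar>1 / ?N * (\<Sum>s\<in>branches. ?t s)\<bar> = \<bar>\<Sum>s\<in>branches. ?t s\<bar> / ?N"
    by (simp add: abs_mult)
  also have "\<dots> \<le> A + M * (w (vtx m i) + Q + E + \<epsilon>)"
    using 1 N by (simp add: pos_divide_le_eq mult.commute)
  finally have 2: "\<bar>1 / ?N * (\<Sum>s\<in>branches. ?t s)\<bar> \<le> A + M * (w (vtx m i) + Q + E + \<epsilon>)" .
  have 3: "\<bar>dt * fcost P (real k * dt) (vtx m i) a\<bar> \<le> dt * M"
    unfolding abs_mult using f dt by (intro mult_mono) auto
  have "\<bar>Sab P cbar p d m dt k i \<Phi> a b\<bar>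
      \<le> \<bar>1 / ?N * (\<Sum>s\<in>branches. ?t s)\<bar> + \<bar>dt * fcost P (real k * dt) (vtx m i) a\<bar>"
    unfolding Sab_def by (rule abs_triangle_ineq)
  then show ?thesis using 2 3 by (simp add: algebra_simps)
qed

lemma Sop_abs_le:
  assumes "ctrlA P \<noteq> {}" "ctrlB P \<noteq> {}"
    and "\<And>a b. a \<in> ctrlA P \<Longrightarrow> b \<in> ctrlB P \<Longrightarrow> \<bar>Sab P cbar p d m dt k i \<Phi> a b\<bar> \<le> X"
  shows "\<bar>Sop P cbar p d m dt k i \<Phi>\<bar> \<le> X"
  unfolding Sop_def by (rule cInf_abs_ge) (use assms in auto)

lemma continuous_on_compact_bounded:
  fixes f :: "'a::topological_space \<Rightarrow> 'b::real_normed_vector"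
  assumes "continuous_on S f" "compact S"
  shows "\<exists>M\<ge>0. \<forall>x\<in>S. norm (f x) \<le> M"
proof -
  have "bounded (f ` S)" using assms by (intro compact_imp_bounded compact_continuous_image)
  then show ?thesis by (auto simp: bounded_pos intro: less_imp_le)
qed

definition data_bounded :: "('n::finite, 'm::finite, 'a::finite, 'b::finite) problem \<Rightarrow> real \<Rightarrow> bool" where
  "data_bounded P M \<longleftrightarrow> 0 \<le> M \<and>
     (\<forall>t\<in>{0..horizon P}. \<forall>x\<in>closure (dom P). \<forall>a\<in>ctrlA P.
        (\<forall>j. norm (column j (sigma P t x a)) \<le> M) \<and> norm (mu P t x a) \<le> M \<and> \<bar>fcost P t x a\<bar> \<le> M) \<and>
     (\<forall>t\<in>{0..horizon P}. \<forall>x\<in>frontier (dom P). \<forall>b\<in>ctrlB P. \<bar>gcost P t x b\<bar> \<le> M) \<and>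
     (\<forall>x\<in>closure (dom P). \<bar>Psi P x\<bar> \<le> M)"

lemma data_boundedD:
  assumes "data_bounded P M"
  shows "0 \<le> M"
    and "\<And>t x a j. t \<in> {0..horizon P} \<Longrightarrow> x \<in> closure (dom P) \<Longrightarrow> a \<in> ctrlA P \<Longrightarrow>
           norm (column j (sigma P t x a)) \<le> M"
    and "\<And>t x a. t \<in> {0..horizon P} \<Longrightarrow> x \<in> closure (dom P) \<Longrightarrow> a \<in> ctrlA P \<Longrightarrow>
           norm (mu P t x a) \<le> M"
    and "\<And>t x a. t \<in> {0..horizon P} \<Longrightarrow> x \<in> closure (dom P) \<Longrightarrow> a \<in> ctrlA P \<Longrightarrow>
           \<bar>fcost P t x a\<bar> \<le> M"
    and "\<And>t x b. t \<in> {0..horizon P} \<Longrightarrow> x \<in> frontier (dom P) \<Longrightarrow> b \<in> ctrlB P \<Longrightarrow>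
           \<bar>gcost P t x b\<bar> \<le> M"
    and "\<And>x. x \<in> closure (dom P) \<Longrightarrow> \<bar>Psi P x\<bar> \<le> M"
  using assms by (simp_all add: data_bounded_def)

lemma ex_data_bounded:
  fixes P :: "('n::finite, 'm::finite, 'a::finite, 'b::finite) problem"
  assumes "standing_assumptions P n"
  shows "\<exists>M. data_bounded P M"
proof -
  have cont: "continuous_on ({0..horizon P} \<times> closure (dom P) \<times> ctrlA P) (\<lambda>(t, x, a). sigma P t x a)"
     "continuous_on ({0..horizon P} \<times> closure (dom P) \<times> ctrlA P) (\<lambda>(t, x, a). mu P t x a)"
     "continuous_on ({0..horizon P} \<times> closure (dom P) \<times> ctrlA P) (\<lambda>(t, x, a). fcost P t x a)"
     "continuous_on ({0..horizon P} \<times> frontier (dom P) \<times> ctrlB P) (\<lambda>(t, x, b). gcost P t x b)"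
     "continuous_on (closure (dom P)) (Psi P)"
    and cpt: "compact (ctrlA P)" "compact (ctrlB P)" and bd: "bounded (dom P)"
    using assms by (simp_all add: standing_assumptions_def)
  have cl: "compact (closure (dom P))" "compact (frontier (dom P))"
    using bd by (auto simp: compact_frontier_bounded)
  have c1: "compact ({0..horizon P} \<times> closure (dom P) \<times> ctrlA P)"
    and c2: "compact ({0..horizon P} \<times> frontier (dom P) \<times> ctrlB P)"
    using cpt cl by (auto intro!: compact_Times)
  obtain M1 where M1: "M1 \<ge> 0" "\<forall>z\<in>{0..horizon P} \<times> closure (dom P) \<times> ctrlA P.
      norm ((\<lambda>(t, x, a). sigma P t x a) z) \<le> M1"
    using continuous_on_compact_bounded[OF cont(1) c1] by blast
  obtain M2 where M2: "M2 \<ge> 0" "\<forall>z\<in>{0..horizon P} \<times> closure (dom P) \<times> ctrlA P.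
      norm ((\<lambda>(t, x, a). mu P t x a) z) \<le> M2"
    using continuous_on_compact_bounded[OF cont(2) c1] by blast
  obtain M3 where M3: "M3 \<ge> 0" "\<forall>z\<in>{0..horizon P} \<times> closure (dom P) \<times> ctrlA P.
      norm ((\<lambda>(t, x, a). fcost P t x a) z) \<le> M3"
    using continuous_on_compact_bounded[OF cont(3) c1] by blast
  obtain M4 where M4: "M4 \<ge> 0" "\<forall>z\<in>{0..horizon P} \<times> frontier (dom P) \<times> ctrlB P.
      norm ((\<lambda>(t, x, b). gcost P t x b) z) \<le> M4"
    using continuous_on_compact_bounded[OF cont(4) c2] by blast
  obtain M5 where M5: "M5 \<ge> 0" "\<forall>x\<in>closure (dom P). norm (Psi P x) \<le> M5"
    using continuous_on_compact_bounded[OF cont(5) cl(1)] by blast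
  define M where "M = M1 + M2 + M3 + M4 + M5"
  have le: "M1 \<le> M" "M2 \<le> M" "M3 \<le> M" "M4 \<le> M" "M5 \<le> M" "0 \<le> M"
    using M1(1) M2(1) M3(1) M4(1) M5(1) by (simp_all add: M_def)
  have "data_bounded P M"
    unfolding data_bounded_def
  proof (intro conjI ballI allI)
    fix t x a assume "t \<in> {0..horizon P}" "x \<in> closure (dom P)" "a \<in> ctrlA P"
    then have z: "(t, x, a) \<in> {0..horizon P} \<times> closure (dom P) \<times> ctrlA P" by simp
    show "norm (column j (sigma P t x a)) \<le> M" for j
      using bspec[OF M1(2) z] le(1) norm_column_le[of j "sigma P t x a"] by simp
    show "norm (mu P t x a) \<le> M" using bspec[OF M2(2) z] le(2) by simp
    show "\<bar>fcost P t x a\<bar> \<le> M" using bspec[OF M3(2) z] le(3) by simp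
  next
    fix t x b assume "t \<in> {0..horizon P}" "x \<in> frontier (dom P)" "b \<in> ctrlB P"
    then have z: "(t, x, b) \<in> {0..horizon P} \<times> frontier (dom P) \<times> ctrlB P" by simp
    show "\<bar>gcost P t x b\<bar> \<le> M" using bspec[OF M4(2) z] le(4) by simp
  next
    fix x assume "x \<in> closure (dom P)"
    then show "\<bar>Psi P x\<bar> \<le> M" using bspec[OF M5(2), of x] le(5) by simp
  qed (rule le)
  then show ?thesis ..
qed

lemma backward_induction_bound:
  fixes N :: nat and u :: "nat \<Rightarrow> 'i \<Rightarrow> real"
  assumes last: "\<And>i. i \<in> I \<Longrightarrow> \<bar>u N i\<bar> \<le> A + \<omega> i"
    and step: "\<And>k A. k < N \<Longrightarrow> (\<And>i. i \<in> I \<Longrightarrow> \<bar>u (Suc k) i\<bar> \<le> A + \<omega> i) \<Longrightarrow>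
       (\<And>i. i \<in> I \<Longrightarrow> \<bar>u k i\<bar> \<le> (A + c) + \<omega> i)"
    and k: "k \<le> N" and i: "i \<in> I"
  shows "\<bar>u k i\<bar> \<le> (A + real (N - k) * c) + \<omega> i"
proof -
  have "\<forall>i\<in>I. \<bar>u k i\<bar> \<le> (A + real (N - k) * c) + \<omega> i" using k
  proof (induction rule: inc_induct)
    case base
    then show ?case using last by simp
  next
    case (step k)
    have "\<bar>u k i\<bar> \<le> ((A + real (N - Suc k) * c) + c) + \<omega> i" if "i \<in> I" for i
      using step assms(2)[of k "A + real (N - Suc k) * c"] that by blast
    moreover have "real (N - k) = real (N - Suc k) + 1" using step by simp
    ultimately show ?case by (simp add: algebra_simps)
  qed
  then show ?thesis using i by blast
qed

lemma time_in_horizon: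
  assumes "dt > 0" "k \<le> num_steps P dt" "horizon P > 0"
  shows "real k * dt \<in> {0..horizon P}"
proof -
  have "real k \<le> real (num_steps P dt)" using assms(2) by simp
  also have "\<dots> \<le> horizon P / dt"
    unfolding num_steps_def using assms by (simp add: of_nat_floor)
  finally show ?thesis using assms by (simp add: pos_le_divide_eq)
qed

text \<open>Since \<open>dt \<le> sqrt dt\<close> for \<open>dt \<le> 1\<close>, the drift is dominated by the diffusive scale.\<close>

lemma drift_diffusion_increment_le:
  fixes P :: "('n::finite, 'm::finite, 'a::finite, 'b::finite) problem"
  assumes db: "data_bounded P M" and t: "t \<in> {0..horizon P}"
    and x: "x \<in> closure (dom P)" and a: "a \<in> ctrlA P" and dt: "0 < dt" "dt \<le> 1"
  shows "norm (dt *\<^sub>R mu P t x a) + sqrt (real CARD('m) * dt) * M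
           \<le> M * (1 + sqrt (real CARD('m))) * sqrt dt"
proof -
  have "dt \<le> sqrt dt" using dt by (simp add: real_le_rsqrt power2_eq_square mult_left_le_one_le)
  then have "dt * norm (mu P t x a) \<le> sqrt dt * M"
    using data_boundedD(3)[OF db t x a] dt by (intro mult_mono) auto
  then show ?thesis
    using dt by (simp add: real_sqrt_mult algebra_simps)
qed

lemma ypt_displacement_le:
  fixes P :: "('n::finite, 'm::finite, 'a::finite, 'b::finite) problem"
  assumes db: "data_bounded P M" and t: "real k * dt \<in> {0..horizon P}"
    and x: "vtx m i \<in> closure (dom P)" and a: "a \<in> ctrlA P"
    and dt: "0 < dt" "dt \<le> 1" and s: "s \<in> branches"
  shows "norm (ypt P m dt k i s a - vtx m i) \<le> M * (1 + sqrt (real CARD('m))) * sqrt dt"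
proof -
  let ?v = "dt *\<^sub>R mu P (real k * dt) (vtx m i) a"
  let ?c = "(fst s * sqrt (real CARD('m) * dt)) *\<^sub>R column (snd s) (sigma P (real k * dt) (vtx m i) a)"
  have "\<bar>fst s\<bar> = 1" using s by auto
  then have "norm ?c \<le> sqrt (real CARD('m) * dt) * M"
    using data_boundedD(2)[OF db t x a] dt by (simp add: abs_mult mult_left_mono)
  moreover have "ypt P m dt k i s a - vtx m i = ?v + ?c"
    by (simp add: ypt_def)
  ultimately show ?thesis
    using drift_diffusion_increment_le[OF db t x a dt] norm_triangle_ineq[of ?v ?c] by simp
qed

lemma ypt_average:
  fixes P :: "('n::finite, 'm::finite, 'a::finite, 'b::finite) problem"
  assumes db: "data_bounded P M" and t: "real k * dt \<in> {0..horizon P}"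
    and x: "vtx m i \<in> closure (dom P)" and a: "a \<in> ctrlA P"
    and dt: "0 < dt" "dt \<le> 1" and C: "C11_on UNIV K w G"
  shows "(\<Sum>s\<in>branches. w (ypt P m dt k i s a))
     \<le> 2 * real CARD('m) * (w (vtx m i) + K * (M + (M * (1 + sqrt (real CARD('m))))\<^sup>2) * dt)"
proof -
  note D = data_boundedD[OF db]
  have K: "0 \<le> K" using C by (simp add: C11_on_def)
  let ?z = "dt *\<^sub>R mu P (real k * dt) (vtx m i) a" and ?h = "sqrt (real CARD('m) * dt)"
  let ?D = "M * (1 + sqrt (real CARD('m)))"
  have "(\<Sum>s\<in>branches. w (ypt P m dt k i s a))
      \<le> 2 * real CARD('m) * (w (vtx m i) + (K * norm ?z + K * (norm ?z + ?h * M)\<^sup>2))"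
    unfolding ypt_def using dt D(2)[OF t x a] by (intro branch_average_le[OF C]) auto
  also have "\<dots> \<le> 2 * real CARD('m) * (w (vtx m i) + (K * (dt * M) + K * (?D * sqrt dt)\<^sup>2))"
  proof (intro mult_left_mono add_left_mono add_mono power_mono)
    show "norm ?z \<le> dt * M" using D(3)[OF t x a] dt by (simp add: mult_left_mono)
    show "norm ?z + ?h * M \<le> ?D * sqrt dt"
      by (rule drift_diffusion_increment_le[OF db t x a dt])
    show "0 \<le> norm ?z + ?h * M" using D(1) dt by simp
  qed (use K in auto)
  also have "K * (dt * M) + K * (?D * sqrt dt)\<^sup>2 = K * (M + ?D\<^sup>2) * dt"
    unfolding power_mult_distrib real_sqrt_pow2[OF less_imp_le[OF dt(1)]] by (simp only: algebra_simps)
  finally show ?thesis .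
qed

text \<open>An exiting branch crosses the boundary between \<open>vtx m i\<close> and \<open>ypt\<close>, so it ends within distance
\<open>D * sqrt dt\<close> of the boundary and its oblique distance is at most \<open>L * D * sqrt dt\<close>. The two smallness
conditions say that it is close enough for the Lipschitz bound to apply and for the sign of
the oblique distance to be determined.\<close>

lemma reflection_step:
  fixes P :: "('n::finite, 'm::finite, 'a::finite, 'b::finite) problem"
  assumes ob: "oblique_barrier (dom P) (ctrlB P) (gam P) UNIV K w G"
    and op: "oblique_projection P R p d" and b: "b \<in> ctrlB P"
    and unit: "\<And>q. q \<in> frontier (dom P) \<Longrightarrow> norm (gam P q b) = 1"
    and lip: "\<And>q y. q \<in> frontier (dom P) \<Longrightarrow> y \<in> tube (dom P) R \<Longrightarrow> dist y q < e \<Longrightarrow>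
        \<bar>d y b\<bar> \<le> L * dist y q"
    and L: "0 \<le> L" and cbar: "cbar > 0" and dt: "dt > 0"
    and x: "vtx m i \<in> closure (dom P)"
    and wd: "ypt P m dt k i s a \<notin> closure (dom P) \<Longrightarrow>
        ypt P m dt k i s a \<in> tube (dom P) R \<and> reflected P cbar p dt (ypt P m dt k i s a) b \<in> closure (dom P)"
    and disp: "norm (ypt P m dt k i s a - vtx m i) \<le> D * sqrt dt"
    and small: "D * sqrt dt < e" "K * (L * (D * sqrt dt)) < 1"
  shows "ytil P cbar p m dt k i s a b \<in> closure (dom P) \<and> 0 \<le> dtil P cbar d m dt k i s a b \<and>
      w (ytil P cbar p m dt k i s a b) + dtil P cbar d m dt k i s a b
        \<le> w (ypt P m dt k i s a) + K * ((L * D)\<^sup>2 + cbar\<^sup>2) * dt"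
proof -
  define y where "y = ypt P m dt k i s a"
  have K: "0 \<le> K" using ob by (simp add: oblique_barrier_def C11_on_def)
  show ?thesis
  proof (cases "y \<in> closure (dom P)")
    case True
    then show ?thesis using K dt by (simp add: ytil_def dtil_def y_def[symmetric])
  next
    case False
    have ytube: "y \<in> tube (dom P) R" and ref: "reflected P cbar p dt y b \<in> closure (dom P)"
      using wd False by (auto simp: y_def)
    obtain q0 where q0: "q0 \<in> frontier (dom P)" "dist y q0 \<le> dist y (vtx m i)"
      using exit_segment_meets_frontier[OF x False] by blast
    have dy: "dist y q0 \<le> D * sqrt dt" using q0(2) disp by (simp add: dist_norm y_def)
    have "\<bar>d y b\<bar> \<le> L * dist y q0" using lip[OF q0(1) ytube] dy small(1) by linarith
    also have "\<dots> \<le> L * (D * sqrt dt)" using dy L by (rule mult_left_mono)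
    finally have dle: "\<bar>d y b\<bar> \<le> L * (D * sqrt dt)" .
    have q: "p y b \<in> frontier (dom P)" and yq: "y = p y b + d y b *\<^sub>R gam P (p y b) b"
      using op ytube b unfolding oblique_projection_def by blast+
    have "K * \<bar>d y b\<bar> \<le> K * (L * (D * sqrt dt))" using dle K by (rule mult_left_mono)
    then have "K * \<bar>d y b\<bar> < 1" using small(2) by linarith
    note R = barrier_reflection[where \<gamma> = "gam P", OF ob q b unit[OF q] yq False this, of "cbar * sqrt dt"]
    have e0: "0 \<le> cbar * sqrt dt" using cbar dt by simp
    have "(d y b)\<^sup>2 \<le> (L * (D * sqrt dt))\<^sup>2" using dle by (metis abs_ge_zero power2_abs power_mono)
    then have "(d y b)\<^sup>2 + (cbar * sqrt dt)\<^sup>2 \<le> ((L * D)\<^sup>2 + cbar\<^sup>2) * dt"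
      using dt by (simp add: power_mult_distrib algebra_simps)
    then have "K * ((d y b)\<^sup>2 + (cbar * sqrt dt)\<^sup>2) \<le> K * (((L * D)\<^sup>2 + cbar\<^sup>2) * dt)"
      using K by (rule mult_left_mono)
    then show ?thesis
      using R[OF e0] e0 ref False
      by (simp add: ytil_def dtil_def y_def[symmetric] reflected_def Let_def mult.assoc)
  qed
qed

section \<open>Stability\<close>

theorem proposition4p3:
  fixes P :: "('n::finite, 'm::finite, 'a::finite, 'b::finite) problem"
    and n :: "real^'n \<Rightarrow> real^'n"
    and H :: "real set"
    and M :: "real \<Rightarrow> 'n mesh"
    and R cbar dtbar :: real
    and p :: "real^'n \<Rightarrow> real^'b \<Rightarrow> real^'n"
    and d :: "real^'n \<Rightarrow> real^'b \<Rightarrow> real"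
  assumes "standing_assumptions P n"
    and "mesh_family (dom P) H M"
    and "R > 0" and "unique_oblique_projection P R p d"
    and "cbar > 0"
    and "dtbar > 0" and "scheme_well_defined P H M R p cbar dtbar"
  shows "\<forall>\<kappa>>0. \<exists>dt0 C. 0 < dt0 \<and> dt0 \<le> dtbar \<and> C > 0 \<and>
    (\<forall>dt\<in>{0<..dt0}. \<forall>dx\<in>H. dx\<^sup>2 / dt \<le> \<kappa> \<longrightarrow>
      (\<forall>U. solves_scheme P cbar p d (M dx) dt U \<longrightarrow>
        (\<forall>k<num_steps P dt. \<forall>i\<in>{1..nvert (M dx)}. \<bar>U k i\<bar> \<le> C)))"
proof (intro allI impI)
  fix \<kappa> :: real assume \<kappa>: "\<kappa> > 0"
  have hor: "horizon P > 0" and bd: "bounded (dom P)" and bc: "boundary_of_class 3 (dom P)"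
    and A: "ctrlA P \<noteq> {}" and B: "ctrlB P \<noteq> {}" "compact (ctrlB P)" "ctrlB P \<subseteq> nbhdB P"
    and nu: "\<And>x. x \<in> frontier (dom P) \<Longrightarrow> outward_unit_normal (dom P) x (n x)"
    and gC1: "C1_on_set (\<lambda>(x, b). gam P x b) (frontier (dom P) \<times> nbhdB P)"
    and unit: "\<And>x b. x \<in> frontier (dom P) \<Longrightarrow> b \<in> ctrlB P \<Longrightarrow> norm (gam P x b) = 1"
    and pos: "\<And>x b. x \<in> frontier (dom P) \<Longrightarrow> b \<in> ctrlB P \<Longrightarrow> n x \<bullet> gam P x b > 0"
    using assms(1) by (simp_all add: standing_assumptions_def)
  obtain W where db: "data_bounded P W" using ex_data_bounded[OF assms(1)] ..
  note Db = data_boundedD[OF db]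
  have "continuous_on (frontier (dom P) \<times> ctrlB P) (\<lambda>(x, b). gam P x b)"
    by (rule continuous_on_subset[OF C1_on_set_imp_continuous_on[OF gC1]]) (use B(3) in blast)
  from ex_oblique_barrier[OF bd bc nu B(2) this pos]
  obtain K w G where ob: "oblique_barrier (dom P) (ctrlB P) (gam P) UNIV K w G" by blast
  have C: "C11_on UNIV K w G" using ob by (simp add: oblique_barrier_def)
  have K: "0 \<le> K" using C by (simp add: C11_on_def)
  have op: "oblique_projection P R p d" using assms(4) by (simp add: unique_oblique_projection_def)
  from oblique_distance_lipschitz[OF op assms(3) bd B(2)]
  obtain e L where e: "e > 0" and L: "L \<ge> 0"
    and lip: "\<forall>q\<in>frontier (dom P). \<forall>b\<in>ctrlB P. \<forall>y\<in>tube (dom P) R. dist y q < e \<longrightarrow> \<bar>d y b\<bar> \<le> L * dist y q"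
    by blast
  obtain C' where C': "C' > 0" "\<forall>dx\<in>H. \<forall>x\<in>closure (dom P). norm (x - proj (M dx) x) \<le> C' * dx\<^sup>2"
    using assms(2) unfolding mesh_family_def by (elim conjE exE)
  obtain \<delta> where \<delta>: "\<forall>dx\<in>H. straight_mesh (dom P) \<delta> dx (M dx)"
    using assms(2) unfolding mesh_family_def by (elim conjE exE)
  have mesh: "\<And>dx. dx \<in> H \<Longrightarrow> exact_triangulation (dom P) (M dx) \<and> mesh_projection (dom P) (M dx) \<and> P1_basis (M dx)"
    using assms(2) unfolding mesh_family_def by simp
  define D where "D = W * (1 + sqrt (real CARD('m)))"
  have D: "D \<ge> 0" using Db(1) by (simp add: D_def)
  \<comment> \<open>\<open>sqrt dt * \<theta> < 1\<close> yields at once the two smallness conditions of the reflection step and \<open>dt < 1\<close>.\<close>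
  define \<theta> where "\<theta> = D / e + K * (L * D) + 1"
  have \<theta>: "\<theta> \<ge> 1" using D e K L by (simp add: \<theta>_def)
  define dt0 where "dt0 = min dtbar ((1 / (2 * \<theta>))\<^sup>2)"
  have "0 < dt0" "dt0 \<le> dtbar" using assms(6) \<theta> by (auto simp: dt0_def)
  have small: "sqrt dt * \<theta> < 1" if "0 < dt" "dt \<le> dt0" for dt
  proof -
    have "sqrt dt \<le> sqrt ((1 / (2 * \<theta>))\<^sup>2)" using that unfolding dt0_def by (intro real_sqrt_le_mono) simp
    also have "\<dots> = 1 / (2 * \<theta>)" using \<theta> by simp
    finally have "sqrt dt * \<theta> \<le> 1 / (2 * \<theta>) * \<theta>" using \<theta> by (intro mult_right_mono) auto
    also have "\<dots> < 1" using \<theta> by simp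
    finally show ?thesis .
  qed
  define c where "c = W * (K * (W + D\<^sup>2) + K * ((L * D)\<^sup>2 + cbar\<^sup>2) + K * (1 + C') * \<kappa> + 1)"
  have c: "c \<ge> 0" unfolding c_def using Db(1) K C'(1) \<kappa> by simp
  define Cst where "Cst = (W + W * K) + horizon P * c + W * K + 1"
  have Cst: "Cst > 0" unfolding Cst_def using Db(1) K hor c by (simp add: add_nonneg_pos)
  show "\<exists>dt0 C. 0 < dt0 \<and> dt0 \<le> dtbar \<and> C > 0 \<and>
    (\<forall>dt\<in>{0<..dt0}. \<forall>dx\<in>H. dx\<^sup>2 / dt \<le> \<kappa> \<longrightarrow>
      (\<forall>U. solves_scheme P cbar p d (M dx) dt U \<longrightarrow>
        (\<forall>k<num_steps P dt. \<forall>i\<in>{1..nvert (M dx)}. \<bar>U k i\<bar> \<le> C)))"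
  proof (intro exI conjI ballI allI impI)
    fix dt dx U k i
    assume dt: "dt \<in> {0<..dt0}" and dx: "dx \<in> H" and ratio: "dx\<^sup>2 / dt \<le> \<kappa>"
      and U: "solves_scheme P cbar p d (M dx) dt U"
      and k: "k < num_steps P dt" and i: "i \<in> {1..nvert (M dx)}"
    have dtp: "0 < dt" "dt \<le> dt0" using dt by auto
    note sm = small[OF dtp]
    have "sqrt dt \<le> sqrt dt * \<theta>" using \<theta> dtp by (simp add: mult_le_cancel_left1)
    then have "sqrt dt < 1" using sm by linarith
    then have dt1: "dt \<le> 1" by simp
    have prods: "0 \<le> sqrt dt * (D / e)" "0 \<le> sqrt dt * (K * (L * D))" using D e K L dtp by auto
    moreover have "sqrt dt * \<theta> = sqrt dt * (D / e) + sqrt dt * (K * (L * D)) + sqrt dt"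
      unfolding \<theta>_def by (simp only: distrib_left mult_1_right)
    moreover have "0 < sqrt dt" using dtp by simp
    ultimately have "sqrt dt * (D / e) < 1" and s2': "sqrt dt * (K * (L * D)) < 1"
      using sm by linarith+
    then have s1: "D * sqrt dt < e" using e by (simp add: pos_divide_less_eq mult.commute)
    have s2: "K * (L * (D * sqrt dt)) < 1" using s2' by (simp add: mult_ac)
    have dx2: "dx\<^sup>2 \<le> \<kappa> * dt" using ratio dtp by (simp add: pos_divide_le_eq)
    have smh: "straight_mesh (dom P) \<delta> dx (M dx)" using \<delta> dx by blast
    note ms = mesh[OF dx]
    have vin: "vtx (M dx) j \<in> closure (dom P)" if "j \<in> {1..nvert (M dx)}" for j
      using vtx_in_closure[OF smh _ that] ms by blast
    have wK: "\<bar>w x\<bar> \<le> K" for x using C11_onD(2)[OF C] by simp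
    \<comment> \<open>The factor \<open>W\<close> bounds the boundary cost, so that \<open>W * w\<close> absorbs it.\<close>
    define \<omega> where "\<omega> j = W * w (vtx (M dx) j)" for j
    have \<omega>: "\<bar>\<omega> j\<bar> \<le> W * K" for j
      unfolding \<omega>_def abs_mult using Db(1) wK by (intro mult_mono) auto
    have step: "\<bar>U k i\<bar> \<le> (A0 + c * dt) + \<omega> i"
      if k: "k < num_steps P dt" and IH: "\<And>j. j \<in> {1..nvert (M dx)} \<Longrightarrow> \<bar>U (Suc k) j\<bar> \<le> A0 + \<omega> j"
        and i: "i \<in> {1..nvert (M dx)}" for k A0 i
    proof -
      have t: "real k * dt \<in> {0..horizon P}" using k dtp hor by (intro time_in_horizon) auto
      have "\<bar>Sab P cbar p d (M dx) dt k i (U (Suc k)) a b\<bar> \<le> (A0 + c * dt) + \<omega> i"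
        if a: "a \<in> ctrlA P" and b: "b \<in> ctrlB P" for a b
      proof -
        have refl: "ytil P cbar p (M dx) dt k i s a b \<in> closure (dom P) \<and> 0 \<le> dtil P cbar d (M dx) dt k i s a b \<and>
            w (ytil P cbar p (M dx) dt k i s a b) + dtil P cbar d (M dx) dt k i s a b
            \<le> w (ypt P (M dx) dt k i s a) + K * ((L * D)\<^sup>2 + cbar\<^sup>2) * dt"
          and wd: "ypt P (M dx) dt k i s a \<notin> closure (dom P) \<Longrightarrow> ypt P (M dx) dt k i s a \<in> tube (dom P) R"
          if s: "s \<in> branches" for s
        proof -
          have "dt \<in> {0<..dtbar}" using dtp \<open>dt0 \<le> dtbar\<close> by simp
          then have wd: "ypt P (M dx) dt k i s a \<notin> closure (dom P) \<Longrightarrow>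
            ypt P (M dx) dt k i s a \<in> tube (dom P) R \<and>
            reflected P cbar p dt (ypt P (M dx) dt k i s a) b \<in> closure (dom P)"
            using assms(7)[unfolded scheme_well_defined_def Let_def, rule_format, of dt dx k i a b s]
              dx k i a b s by blast
          then show "ypt P (M dx) dt k i s a \<notin> closure (dom P) \<Longrightarrow> ypt P (M dx) dt k i s a \<in> tube (dom P) R"
            by blast
          show "ytil P cbar p (M dx) dt k i s a b \<in> closure (dom P) \<and> 0 \<le> dtil P cbar d (M dx) dt k i s a b \<and>
            w (ytil P cbar p (M dx) dt k i s a b) + dtil P cbar d (M dx) dt k i s a b
            \<le> w (ypt P (M dx) dt k i s a) + K * ((L * D)\<^sup>2 + cbar\<^sup>2) * dt"
          proof (rule reflection_step[OF ob op b unit[OF _ b] _ L assms(5) dtp(1) vin[OF i] wd _ s1 s2])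
            show "norm (ypt P (M dx) dt k i s a - vtx (M dx) i) \<le> D * sqrt dt"
              unfolding D_def by (rule ypt_displacement_le[OF db t vin[OF i] a dtp(1) dt1 s])
          qed (use lip b in auto)
        qed
        have "\<bar>Sab P cbar p d (M dx) dt k i (U (Suc k)) a b\<bar> \<le> A0 + W * w (vtx (M dx) i)
           + W * (K * (W + D\<^sup>2) * dt + K * ((L * D)\<^sup>2 + cbar\<^sup>2) * dt + K * (1 + C') * dx\<^sup>2 + dt)"
        proof (rule Sab_abs_le)
          fix s assume s: "s \<in> (branches :: (real \<times> 'm) set)"
          let ?yt = "ytil P cbar p (M dx) dt k i s a b"
          have cl: "?yt \<in> closure (dom P)" using refl[OF s] by blast
          show "0 \<le> dtil P cbar d (M dx) dt k i s a b \<and>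
              w ?yt + dtil P cbar d (M dx) dt k i s a b
              \<le> w (ypt P (M dx) dt k i s a) + K * ((L * D)\<^sup>2 + cbar\<^sup>2) * dt"
            using refl[OF s] by blast
          have "\<bar>interp (M dx) (U (Suc k)) ?yt\<bar> \<le> A0 + W * interp (M dx) (\<lambda>j. w (vtx (M dx) j)) ?yt"
            using IH ms cl by (intro interp_abs_le[OF smh]) (auto simp: \<omega>_def)
          also have "\<dots> \<le> A0 + W * (w ?yt + K * (1 + C') * dx\<^sup>2)"
          proof (intro add_left_mono mult_left_mono Db(1))
            have "\<bar>interp (M dx) (\<lambda>j. w (vtx (M dx) j)) ?yt - w ?yt\<bar> \<le> K * (1 + C') * dx\<^sup>2"
              using ms cl C'(2) dx by (intro interp_error_C11[OF smh _ _ C]) auto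
            then show "interp (M dx) (\<lambda>j. w (vtx (M dx) j)) ?yt \<le> w ?yt + K * (1 + C') * dx\<^sup>2"
              by linarith
          qed
          finally show "\<bar>interp (M dx) (U (Suc k)) ?yt\<bar> \<le> A0 + W * (w ?yt + K * (1 + C') * dx\<^sup>2)" .
          show "\<bar>gtil P p (M dx) dt k i s a b\<bar> \<le> W"
          proof (cases "ypt P (M dx) dt k i s a \<in> closure (dom P)")
            case False
            then have "p (ypt P (M dx) dt k i s a) b \<in> frontier (dom P)"
              using wd[OF s] op b unfolding oblique_projection_def by blast
            then show ?thesis using False Db(5)[OF t _ b] by (simp add: gtil_def Let_def)
          qed (simp add: gtil_def Db(1))
        next
          show "(\<Sum>s\<in>branches. w (ypt P (M dx) dt k i s a))
              \<le> 2 * real CARD('m) * (w (vtx (M dx) i) + K * (W + D\<^sup>2) * dt)"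
            unfolding D_def by (rule ypt_average[OF db t vin[OF i] a dtp(1) dt1 C])
          show "\<bar>fcost P (real k * dt) (vtx (M dx) i) a\<bar> \<le> W" by (rule Db(4)[OF t vin[OF i] a])
        qed (use Db(1) dtp in auto)
        also have "\<dots> \<le> A0 + W * w (vtx (M dx) i)
           + W * (K * (W + D\<^sup>2) * dt + K * ((L * D)\<^sup>2 + cbar\<^sup>2) * dt + K * (1 + C') * (\<kappa> * dt) + dt)"
          using dx2 K C'(1) Db(1) by (intro add_mono mult_left_mono) auto
        also have "\<dots> = (A0 + c * dt) + \<omega> i"
          unfolding c_def \<omega>_def by (simp add: algebra_simps)
        finally show ?thesis .
      qed
      then have "\<bar>Sop P cbar p d (M dx) dt k i (U (Suc k))\<bar> \<le> (A0 + c * dt) + \<omega> i"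
        using A B(1) by (intro Sop_abs_le)
      then show ?thesis using U k i by (simp add: solves_scheme_def)
    qed
    \<comment> \<open>\<open>w\<close> may be negative inside the domain; the constant \<open>W * K\<close> makes the bound hold at the final time.\<close>
    have "\<bar>U k i\<bar> \<le> ((W + W * K) + real (num_steps P dt - k) * (c * dt)) + \<omega> i"
    proof (rule backward_induction_bound[where I = "{1..nvert (M dx)}", OF _ step _ i])
      fix j assume j: "j \<in> {1..nvert (M dx)}"
      have "\<bar>U (num_steps P dt) j\<bar> \<le> W" using U j Db(6)[OF vin[OF j]] by (simp add: solves_scheme_def)
      then show "\<bar>U (num_steps P dt) j\<bar> \<le> (W + W * K) + \<omega> j" using \<omega>[of j] by linarith
    qed (use k in auto)
    also have "real (num_steps P dt - k) * (c * dt) \<le> horizon P * c"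
    proof -
      have "real (num_steps P dt - k) * dt \<in> {0..horizon P}" using dtp hor by (intro time_in_horizon) auto
      then have "(real (num_steps P dt - k) * dt) * c \<le> horizon P * c" using c by (intro mult_right_mono) auto
      then show ?thesis by (simp add: mult_ac)
    qed
    finally show "\<bar>U k i\<bar> \<le> Cst" using \<omega>[of i] unfolding Cst_def by linarith
  qed (fact \<open>0 < dt0\<close> \<open>dt0 \<le> dtbar\<close> Cst)+
qed

end
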